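(* Let $m \ge 1$ and let $w \in \mathfrak{S}_{2m}$ be a fully supported permutation. Then $w$ has maximally many forced right-perimeter tiles (that is, exactly $m$ of them) if and only if $w(2k-1) > w(2k)$ for all $1 \le k \le m$, and $$w(1) < w(3) < \cdots < w(2m-1) \quad\text{and}\quad w(2) < w(4) < \cdots < w(2m).$$
   Context: Permutations are written in one-line notation $w = w(1)w(2)\cdots w(n)$. A permutation $w \in \mathfrak{S}_n$ is fully supported if $\{w(1),\ldots,w(r)\} \ne \{1,\ldots,r\}$ for all $1 \le r < n$ (equivalently, every simple reflection appears in its reduced decompositions). Elnitsky polygon. For fully supported $w \in \mathfrak{S}_n$, $n \ge 2$, Elnitsky's polygon $X(w)$ is the equilateral $2n$-gon whose sides, read counterclockwise starting at the top vertex, are labeled $1,\ldots,n,w(n),\ldots,w(1)$, such that the first $n$ sides form half of a convex $2n$-gon and sides with the same label are parallel. Concretely: fix unit vectors $v_1,\ldots,v_n$ in the plane with angles $\pi < \theta_1 < \cdots < \theta_n < 2\pi$; with the top vertex at the origin, the leftside boundary is the path with vertices $v_1+\cdots+v_k$ ($0\le k\le n$), its $k$th edge labeled $k$, and the rightside boundary is the path with vertices $v_{w(1)}+\cdots+v_{w(k)}$ ($0 \le k \le n$), its $k$th edge labeled $w(k)$. Both paths end at the bottom vertex, and $X(w)$ is the region they bound. Tilings. A rhombic tiling of $X(w)$ is an (edge-to-edge) tiling by rhombi whose edges are all congruent and parallel to edges of $X(w)$ (unit rhombi with sides parallel to $v_i$ and $v_j$, $i \ne j$). $T(w)$ is the set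 of all rhombic tilings of $X(w)$. The labels of a tile are the labels $\{i,j\}$ of the sides of $X(w)$ to which its edges are parallel. In any tiling no two tiles have the same labels, so a tile is identified with its label set: "the tile $\{x,y\}$". Perimeter tiles. A tile of $T \in T(w)$ is a right-perimeter tile if it shares two consecutive edges with the rightside boundary of $X(w)$. The tile $\{x,y\}$ is a forced right-perimeter tile for $w$ if in every $T \in T(w)$ the tile $\{x,y\}$ is present and is a right-perimeter tile. A permutation $w \in \mathfrak{S}_n$ has maximally many forced right-perimeter tiles if it has $\lfloor n/2 \rfloor$ of them. *)

theory Defs
  imports "HOL-Analysis.Analysis" "HOL-Combinatorics.Permutations"
begin

text \<open>
  A permutation in \<open>S\<^sub>n\<close> is a function \<open>w :: nat \<Rightarrow> nat\<close> with \<open>w permutes {1..n}\<close>.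
  The plane is \<^typ>\<open>complex\<close>.
\<close>

definition fully_supported :: "nat \<Rightarrow> (nat \<Rightarrow> nat) \<Rightarrow> bool" where
  "fully_supported n w \<longleftrightarrow> (\<forall>r. 1 \<le> r \<and> r < n \<longrightarrow> w ` {1..r} \<noteq> {1..r})"

text \<open>
  The polygon depends on a choice of directions; \<open>\<theta> i\<close> is the angle of the \<open>i\<close>th edge of the
  leftside boundary, oriented from the top vertex (the origin) to the bottom vertex.
\<close>

definition elnitsky_angles :: "nat \<Rightarrow> (nat \<Rightarrow> real) \<Rightarrow> bool" where
  "elnitsky_angles n \<theta> \<longleftrightarrow> strict_mono_on {1..n} \<theta> \<and> \<theta> ` {1..n} \<subseteq> {pi<..<2 * pi}"

text \<open>
  The path from the origin whose \<open>k\<close>th edge is labelled \<open>u k\<close>; the leftside boundary has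
  \<open>u = id\<close>, the rightside boundary has \<open>u = w\<close>.
\<close>

definition path_vertex :: "(nat \<Rightarrow> real) \<Rightarrow> (nat \<Rightarrow> nat) \<Rightarrow> nat \<Rightarrow> complex" where
  "path_vertex \<theta> u k = (\<Sum>i=1..k. cis (\<theta> (u i)))"

definition path_edge :: "(nat \<Rightarrow> real) \<Rightarrow> (nat \<Rightarrow> nat) \<Rightarrow> nat \<Rightarrow> complex set" where
  "path_edge \<theta> u k = closed_segment (path_vertex \<theta> u (k - 1)) (path_vertex \<theta> u k)"

definition elnitsky_boundary :: "nat \<Rightarrow> (nat \<Rightarrow> real) \<Rightarrow> (nat \<Rightarrow> nat) \<Rightarrow> complex set" where
  "elnitsky_boundary n \<theta> w =
     (\<Union>k\<in>{1..n}. path_edge \<theta> id k) \<union> (\<Union>k\<in>{1..n}. path_edge \<theta> w k)"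

definition elnitsky_polygon :: "nat \<Rightarrow> (nat \<Rightarrow> real) \<Rightarrow> (nat \<Rightarrow> nat) \<Rightarrow> complex set" where
  "elnitsky_polygon n \<theta> w = elnitsky_boundary n \<theta> w \<union> inside (elnitsky_boundary n \<theta> w)"

definition rhombus :: "complex \<Rightarrow> complex \<Rightarrow> complex \<Rightarrow> complex set" where
  "rhombus p a b = convex hull {p, p + a, p + b, p + a + b}"

text \<open>\<open>R\<close> is a unit rhombus whose set of labels is \<open>L\<close>.\<close>

definition is_tile :: "nat \<Rightarrow> (nat \<Rightarrow> real) \<Rightarrow> complex set \<Rightarrow> nat set \<Rightarrow> bool" where
  "is_tile n \<theta> R L \<longleftrightarrow>
     (\<exists>p. \<exists>i\<in>{1..n}. \<exists>j\<in>{1..n}. i \<noteq> j \<and> L = {i, j} \<and> R = rhombus p (cis (\<theta> i)) (cis (\<theta> j)))"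

text \<open>
  The last conjunct is the edge-to-edge condition: two tiles meet in a common face (empty, a
  vertex or an edge, since distinct tiles have disjoint interiors).
\<close>

definition rhombic_tilings ::
    "nat \<Rightarrow> (nat \<Rightarrow> real) \<Rightarrow> (nat \<Rightarrow> nat) \<Rightarrow> complex set set set" where
  "rhombic_tilings n \<theta> w = {T.
     finite T \<and>
     (\<forall>R\<in>T. \<exists>L. is_tile n \<theta> R L) \<and>
     \<Union>T = elnitsky_polygon n \<theta> w \<and>
     pairwise (\<lambda>R S. interior R \<inter> interior S = {}) T \<and>
     pairwise (\<lambda>R S. R \<inter> S face_of R \<and> R \<inter> S face_of S) T}"

definition right_perimeter :: "nat \<Rightarrow> (nat \<Rightarrow> real) \<Rightarrow> (nat \<Rightarrow> nat) \<Rightarrow> complex set \<Rightarrow> bool" where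
  "right_perimeter n \<theta> w R \<longleftrightarrow>
     (\<exists>k. 1 \<le> k \<and> k < n \<and> path_edge \<theta> w k edge_of R \<and> path_edge \<theta> w (k + 1) edge_of R)"

text \<open>
  Tiles of different tilings are compared through their label sets, so forced tiles are
  label sets.
\<close>

definition forced_right_perimeter_tiles ::
    "nat \<Rightarrow> (nat \<Rightarrow> real) \<Rightarrow> (nat \<Rightarrow> nat) \<Rightarrow> nat set set" where
  "forced_right_perimeter_tiles n \<theta> w =
     {{x, y} | x y. x \<in> {1..n} \<and> y \<in> {1..n} \<and> x \<noteq> y \<and>
        (\<forall>T\<in>rhombic_tilings n \<theta> w. \<exists>R\<in>T. is_tile n \<theta> R {x, y} \<and> right_perimeter n \<theta> w R)}"

definition maximally_many_forced :: "nat \<Rightarrow> (nat \<Rightarrow> real) \<Rightarrow> (nat \<Rightarrow> nat) \<Rightarrow> bool" where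
  "maximally_many_forced n \<theta> w \<longleftrightarrow> card (forced_right_perimeter_tiles n \<theta> w) = n div 2"

end

(*
  All boundary paths are graphs over the depth, and the polygon is the region between the graph of
  the left path and that of w. In any tiling of such a region, some tile has its right corner at a
  descent w(k) > w(k+1) of the right path; removing it leaves a tiling of the region of the
  permutation with these two entries exchanged. If w(k) is a left-to-right maximum and w(k+1) a
  right-to-left minimum, this never disturbs the positions k and k+1, so the tile {w(k), w(k+1)}
  must be removed at some stage and is forced; under the conditions of the theorem this applies to
  k = 1, 3, ..., 2m-1.
  Conversely, two forced tiles cannot share a boundary edge, so m of them occupy exactly the
  positions 1, 3, ..., 2m-1. If, say, w(2j-1) > w(2j+1), then adding tiles in the order in which
  w(2j-1) passes first w(2j+1) and then w(2j) gives a tiling in which the boundary edge labelled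
  w(2j+1) belongs to the tile {w(2j-1), w(2j+1)} instead of the forced one.
*)
theory Submission
  imports Defs
begin

section \<open>Rhombi\<close>

text \<open>The polygon is defined topologically, through \<open>inside\<close>, but all angles lie
  strictly between \<pi> and 2\<pi>, so every edge descends and everything becomes a condition on
  piecewise affine functions of the depth. Two tiles of a tiling are identified by exhibiting a
  common point of their interiors. The obstacle is that exchanging two entries can destroy full
  support: the boundary paths of the smaller region may touch, and along common stretches the region
  is too thin for any tile. Both inductions therefore run over arbitrary permutations, with separate
  notions of tiling. \<open>weak_tiling\<close> asks so little that it survives the removal of a
  tile; \<open>fitting_tiling\<close> asks for so much, including a proper contact with the right
  path, that a further tile can be glued on edge to edge. Full support matters on the way back to
  the actual polygon: it keeps the two paths apart between top and bottom, so that a fitting tiling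
  covers the left path as well. The existence of a tiling is itself part of the argument, since over
  an empty set of tilings every pair of labels would be forced.\<close>

lemma rhombus_eq:
  "rhombus p a b = {p + \<alpha> *\<^sub>R a + \<beta> *\<^sub>R b |\<alpha> \<beta>. 0 \<le> \<alpha> \<and> \<alpha> \<le> 1 \<and> 0 \<le> \<beta> \<and> \<beta> \<le> 1}" (is "_ = ?S")
proof
  have "convex ?S"
  proof (rule convexI)
    fix x y :: complex and u v :: real
    assume "x \<in> ?S" "y \<in> ?S" and uv: "0 \<le> u" "0 \<le> v" "u + v = 1"
    then obtain \<alpha> \<beta> \<alpha>' \<beta>' where x: "x = p + \<alpha> *\<^sub>R a + \<beta> *\<^sub>R b" and y: "y = p + \<alpha>' *\<^sub>R a + \<beta>' *\<^sub>R b"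
      and bounds: "0 \<le> \<alpha>" "\<alpha> \<le> 1" "0 \<le> \<beta>" "\<beta> \<le> 1" "0 \<le> \<alpha>'" "\<alpha>' \<le> 1" "0 \<le> \<beta>'" "\<beta>' \<le> 1"
      by blast
    have "u *\<^sub>R x + v *\<^sub>R y
      = (u + v) *\<^sub>R p + (u * \<alpha> + v * \<alpha>') *\<^sub>R a + (u * \<beta> + v * \<beta>') *\<^sub>R b"
      by (simp add: x y algebra_simps)
    then have "u *\<^sub>R x + v *\<^sub>R y = p + (u * \<alpha> + v * \<alpha>') *\<^sub>R a + (u * \<beta> + v * \<beta>') *\<^sub>R b"
      using uv by simp
    moreover have "u * \<alpha> + v * \<alpha>' \<le> 1" "u * \<beta> + v * \<beta>' \<le> 1"
      using bounds uv by (simp_all add: convex_bound_le)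
    moreover have "0 \<le> u * \<alpha> + v * \<alpha>'" "0 \<le> u * \<beta> + v * \<beta>'"
      using bounds uv by simp_all
    ultimately show "u *\<^sub>R x + v *\<^sub>R y \<in> ?S" by blast
  qed
  moreover have "{p, p + a, p + b, p + a + b} \<subseteq> ?S"
  proof -
    have "p + \<alpha> *\<^sub>R a + \<beta> *\<^sub>R b \<in> ?S" if "\<alpha> \<in> {0, 1}" "\<beta> \<in> {0, 1}" for \<alpha> \<beta> :: real
    proof -
      have "0 \<le> \<alpha> \<and> \<alpha> \<le> 1 \<and> 0 \<le> \<beta> \<and> \<beta> \<le> 1" using that by auto
      then show ?thesis by blast
    qed
    from this[of 0 0] this[of 1 0] this[of 0 1] this[of 1 1] show ?thesis by simp
  qed
  ultimately show "rhombus p a b \<subseteq> ?S"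
    unfolding rhombus_def by (rule hull_minimal[rotated])
  show "?S \<subseteq> rhombus p a b"
  proof
    fix z assume "z \<in> ?S"
    then obtain \<alpha> \<beta> where z: "z = p + \<alpha> *\<^sub>R a + \<beta> *\<^sub>R b"
      and bounds: "0 \<le> \<alpha>" "\<alpha> \<le> 1" "0 \<le> \<beta>" "\<beta> \<le> 1" by blast
    have cv: "convex (rhombus p a b)" by (simp add: rhombus_def)
    have in4: "{p, p + a, p + b, p + a + b} \<subseteq> rhombus p a b"
      unfolding rhombus_def by (rule hull_subset)
    have x: "(1 - \<alpha>) *\<^sub>R p + \<alpha> *\<^sub>R (p + a) \<in> rhombus p a b"
      and y: "(1 - \<alpha>) *\<^sub>R (p + b) + \<alpha> *\<^sub>R (p + a + b) \<in> rhombus p a b"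
      using in4 bounds by (auto intro!: convexD[OF cv])
    \<comment> \<open>Interpolating with weight \<alpha> on the two opposite sides parallel to
      \<open>a\<close>, then with weight \<beta> between the two resulting points.\<close>
    have "(1 - \<beta>) *\<^sub>R ((1 - \<alpha>) *\<^sub>R p + \<alpha> *\<^sub>R (p + a))
        + \<beta> *\<^sub>R ((1 - \<alpha>) *\<^sub>R (p + b) + \<alpha> *\<^sub>R (p + a + b)) \<in> rhombus p a b"
      using bounds by (intro convexD[OF cv x y]) auto
    also have "(1 - \<beta>) *\<^sub>R ((1 - \<alpha>) *\<^sub>R p + \<alpha> *\<^sub>R (p + a))
        + \<beta> *\<^sub>R ((1 - \<alpha>) *\<^sub>R (p + b) + \<alpha> *\<^sub>R (p + a + b)) = z"
      by (simp add: z algebra_simps)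
    finally show "z \<in> rhombus p a b" .
  qed
qed

lemma rhombus_commute: "rhombus p a b = rhombus p b a"
proof -
  have "{p, p + a, p + b, p + a + b} = {p, p + b, p + a, p + b + a}"
    by (auto simp: algebra_simps)
  then show ?thesis by (simp only: rhombus_def)
qed

text \<open>Moving the base point to the far end of \<open>b\<close> turns the opposite side
  parallel to \<open>a\<close> into a side at the base point, so that one lemma about a single side
  serves all four.\<close>

lemma rhombus_shift: "rhombus p a b = rhombus (p + b) a (- b)"
proof -
  have "{p, p + a, p + b, p + a + b} = {p + b, p + b + a, p + b + - b, p + b + a + - b}"
    by (auto simp: algebra_simps)
  then show ?thesis by (simp only: rhombus_def)
qed

lemma rhombusI:
  "0 \<le> \<alpha> \<Longrightarrow> \<alpha> \<le> 1 \<Longrightarrow> 0 \<le> \<beta> \<Longrightarrow> \<beta> \<le> 1 \<Longrightarrow>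
    p + \<alpha> *\<^sub>R a + \<beta> *\<^sub>R b \<in> rhombus p a b"
  unfolding rhombus_eq by blast

lemma convex_rhombus: "convex (rhombus p a b)"
  by (simp add: rhombus_def)

lemma closed_rhombus: "closed (rhombus p a b)"
  unfolding rhombus_def
  by (intro compact_imp_closed compact_convex_hull finite_imp_compact) simp

text \<open>Multiplication by \<open>\<i>\<close> is a quarter turn, so the assumption says that
  \<open>a\<close> and \<open>b\<close> are not parallel. The line through the side is then a
  supporting line of the rhombus, with normal \<open>c\<close>.\<close>

lemma segment_face_of_rhombus:
  assumes "(\<i> * a) \<bullet> b \<noteq> 0"
  shows "closed_segment p (p + a) face_of rhombus p a b"
proof -
  \<comment> \<open>The sign turns the normal towards \<open>b\<close>, so that the rhombus lies on
    its nonnegative side.\<close>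
  define \<sigma> :: real where "\<sigma> = sgn ((\<i> * a) \<bullet> b)"
  define c where "c = \<sigma> *\<^sub>R (\<i> * a)"
  have ca: "c \<bullet> a = 0" by (simp add: c_def inner_complex_def)
  have cb: "c \<bullet> b > 0"
    using assms unfolding c_def \<sigma>_def by (simp add: sgn_if)
  have val: "c \<bullet> (p + \<alpha> *\<^sub>R a + \<beta> *\<^sub>R b) = c \<bullet> p + \<beta> * (c \<bullet> b)" for \<alpha> \<beta>
    by (simp add: inner_add_right ca)
  have "rhombus p a b \<inter> {z. c \<bullet> z = c \<bullet> p} face_of rhombus p a b"
  proof (rule face_of_Int_supporting_hyperplane_ge[OF convex_rhombus])
    fix z assume "z \<in> rhombus p a b"
    then show "c \<bullet> z \<ge> c \<bullet> p" using cb by (auto simp: rhombus_eq val)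
  qed
  also have "rhombus p a b \<inter> {z. c \<bullet> z = c \<bullet> p} = closed_segment p (p + a)"
  proof (intro equalityI subsetI)
    fix z assume "z \<in> rhombus p a b \<inter> {z. c \<bullet> z = c \<bullet> p}"
    then obtain \<alpha> \<beta> where z: "z = p + \<alpha> *\<^sub>R a + \<beta> *\<^sub>R b"
      and bounds: "0 \<le> \<alpha>" "\<alpha> \<le> 1" and eq: "c \<bullet> z = c \<bullet> p" by (auto simp: rhombus_eq)
    have "\<beta> = 0" using eq cb by (simp add: z val)
    then have "z = (1 - \<alpha>) *\<^sub>R p + \<alpha> *\<^sub>R (p + a)" by (simp add: z algebra_simps)
    with bounds show "z \<in> closed_segment p (p + a)" unfolding closed_segment_def by blast
  next
    fix z assume "z \<in> closed_segment p (p + a)"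
    then obtain \<alpha> where "0 \<le> \<alpha>" "\<alpha> \<le> 1" and z: "z = (1 - \<alpha>) *\<^sub>R p + \<alpha> *\<^sub>R (p + a)"
      unfolding closed_segment_def by blast
    moreover have z': "z = p + \<alpha> *\<^sub>R a + 0 *\<^sub>R b" by (simp add: z algebra_simps)
    ultimately have "z \<in> rhombus p a b" using rhombusI[of \<alpha> 0 p a b] by simp
    moreover have "c \<bullet> z = c \<bullet> p" unfolding z' val by simp
    ultimately show "z \<in> rhombus p a b \<inter> {z. c \<bullet> z = c \<bullet> p}" by simp
  qed
  finally show ?thesis .
qed

lemma edge_of_segmentI:
  fixes a b :: complex
  assumes "closed_segment a b face_of R" "a \<noteq> b"
  shows "closed_segment a b edge_of R"
  using assms by (simp add: edge_of_def segment_convex_hull aff_dim_convex_hull)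

section \<open>Tiles in the coordinates abscissa and depth\<close>

locale elnitsky =
  fixes n :: nat and \<theta> :: "nat \<Rightarrow> real"
  assumes angles: "elnitsky_angles n \<theta>"
begin

text \<open>
  The plane is described by abscissa and depth (minus the imaginary part); an edge labelled \<open>i\<close>
  descends by \<open>fall i\<close>, with \<open>slope i\<close> being the horizontal displacement per unit of depth.
\<close>

definition fall :: "nat \<Rightarrow> real" where "fall i = - sin (\<theta> i)"

definition slope :: "nat \<Rightarrow> real" where "slope i = cos (\<theta> i) / fall i"

lemma angle_bounds: "i \<in> {1..n} \<Longrightarrow> pi < \<theta> i \<and> \<theta> i < 2 * pi"
  using angles unfolding elnitsky_angles_def greaterThanLessThan_iff[symmetric] by blast

lemma fall_pos: "i \<in> {1..n} \<Longrightarrow> 0 < fall i"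
  using angle_bounds[of i] sin_lt_zero[of "\<theta> i"] by (simp add: fall_def)

text \<open>\<open>slope i\<close> is minus the cotangent of \<open>\<theta> i\<close>; after
  clearing denominators the difference of two slopes is the sine of the difference of the angles,
  which lies between 0 and \<pi>.\<close>

lemma slope_less:
  assumes "i \<in> {1..n}" "j \<in> {1..n}" "i < j"
  shows "slope i < slope j"
proof -
  have th: "\<theta> i < \<theta> j" "pi < \<theta> i" "\<theta> j < 2 * pi"
    using angles assms angle_bounds[of i] angle_bounds[of j] strict_mono_onD[of "{1..n}" \<theta> i j]
    by (simp_all add: elnitsky_angles_def)
  then have "0 < sin (\<theta> j - \<theta> i)" by (intro sin_gt_zero) auto
  then have "cos (\<theta> i) * fall j < cos (\<theta> j) * fall i"
    by (simp add: fall_def sin_diff algebra_simps)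
  then show ?thesis
    using fall_pos assms by (simp add: slope_def divide_simps algebra_simps)
qed

lemma slope_inj: "i \<in> {1..n} \<Longrightarrow> j \<in> {1..n} \<Longrightarrow> slope i = slope j \<Longrightarrow> i = j"
  using slope_less[of i j] slope_less[of j i] by (metis less_irrefl linorder_neqE_nat)

lemma cis_angle: "i \<in> {1..n} \<Longrightarrow> cis (\<theta> i) = Complex (slope i * fall i) (- fall i)"
  using fall_pos[of i] by (simp add: complex_eq_iff slope_def) (simp add: fall_def)

text \<open>For \<open>i < j\<close> and top vertex \<open>p\<close>, the left side of the tile runs
  along \<open>i\<close> and then \<open>j\<close>. The slope increases at the left corner, so the
  broken line is the maximum of the two lines carrying its edges; \<open>right_side\<close> runs
  along \<open>j\<close> and then \<open>i\<close> and is a minimum. The formulas make sense at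
  every depth, and above and below the tile the two sides have crossed, so the inequality between
  them already encodes the vertical extent.\<close>

definition left_side :: "complex \<Rightarrow> nat \<Rightarrow> nat \<Rightarrow> real \<Rightarrow> real" where
  "left_side p i j t = Re p +
     max (slope i * (t + Im p)) (slope j * (t + Im p) - fall i * (slope j - slope i))"

definition right_side :: "complex \<Rightarrow> nat \<Rightarrow> nat \<Rightarrow> real \<Rightarrow> real" where
  "right_side p i j t = Re p +
     min (slope j * (t + Im p)) (slope i * (t + Im p) + fall j * (slope j - slope i))"

abbreviation unit_rhombus :: "complex \<Rightarrow> nat \<Rightarrow> nat \<Rightarrow> complex set" where
  "unit_rhombus p i j \<equiv> rhombus p (cis (\<theta> i)) (cis (\<theta> j))"

lemma unit_rhombus_eq:
  assumes ij: "i \<in> {1..n}" "j \<in> {1..n}" "i < j"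
  shows "unit_rhombus p i j = {z. left_side p i j (- Im z) \<le> Re z \<and> Re z \<le> right_side p i j (- Im z)}"
    (is "_ = ?S")
proof -
  have d: "slope j - slope i > 0" using slope_less ij by simp
  have si: "fall i > 0" and sj: "fall j > 0" using fall_pos ij by auto
  have "z \<in> unit_rhombus p i j \<longleftrightarrow> z \<in> ?S" for z
  proof
    assume "z \<in> unit_rhombus p i j"
    then obtain \<alpha> \<beta> where z: "z = p + \<alpha> *\<^sub>R cis (\<theta> i) + \<beta> *\<^sub>R cis (\<theta> j)"
      and b: "0 \<le> \<alpha>" "\<alpha> \<le> 1" "0 \<le> \<beta>" "\<beta> \<le> 1" by (auto simp: rhombus_eq)
    have re: "Re z = Re p + slope i * (\<alpha> * fall i) + slope j * (\<beta> * fall j)"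
      and im: "Im z = Im p - (\<alpha> * fall i + \<beta> * fall j)"
      using ij by (simp_all add: z cis_angle)
    have "0 \<le> \<beta> * fall j * (slope j - slope i)" "0 \<le> \<alpha> * fall i * (slope j - slope i)"
      "0 \<le> (1 - \<beta>) * (fall j * (slope j - slope i))" "0 \<le> (1 - \<alpha>) * (fall i * (slope j - slope i))"
      using b si sj d by simp_all
    then show "z \<in> ?S"
      by (simp add: left_side_def right_side_def re im algebra_simps)
  next
    assume "z \<in> ?S"
    define t where "t = - Im z + Im p"
    define x where "x = Re z - Re p"
    from \<open>z \<in> ?S\<close> have ineq: "slope i * t \<le> x" "x \<le> slope j * t"
      "slope j * t - fall i * (slope j - slope i) \<le> x" "x \<le> slope i * t + fall j * (slope j - slope i)"
      by (auto simp: left_side_def right_side_def t_def x_def)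
    \<comment> \<open>The weights solve the two linear equations for depth and abscissa,
      \<open>\<alpha> * fall i + \<beta> * fall j = t\<close> and \<open>slope i * (\<alpha> * fall
      i) + slope j * (\<beta> * fall j) = x\<close>.\<close>
    define \<beta> where "\<beta> = (x - slope i * t) / ((slope j - slope i) * fall j)"
    define \<alpha> where "\<alpha> = (slope j * t - x) / ((slope j - slope i) * fall i)"
    have b: "0 \<le> \<alpha>" "\<alpha> \<le> 1" "0 \<le> \<beta>" "\<beta> \<le> 1"
      using ineq d si sj by (simp_all add: \<alpha>_def \<beta>_def divide_simps mult.commute)
    have A: "\<alpha> * fall i = (slope j * t - x) / (slope j - slope i)"
      and B: "\<beta> * fall j = (x - slope i * t) / (slope j - slope i)"
      using si sj by (simp_all add: \<alpha>_def \<beta>_def)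
    have "\<alpha> * fall i + \<beta> * fall j = ((slope j - slope i) * t) / (slope j - slope i)"
      unfolding A B add_divide_distrib[symmetric] by (simp add: left_diff_distrib)
    then have "\<alpha> * fall i + \<beta> * fall j = t" using d by simp
    moreover
    have "slope i * (\<alpha> * fall i) + slope j * (\<beta> * fall j)
        = ((slope j - slope i) * x) / (slope j - slope i)"
      unfolding A B times_divide_eq_right add_divide_distrib[symmetric] by (simp add: algebra_simps)
    then have "slope i * (\<alpha> * fall i) + slope j * (\<beta> * fall j) = x" using d by simp
    ultimately have "z = p + \<alpha> *\<^sub>R cis (\<theta> i) + \<beta> *\<^sub>R cis (\<theta> j)"
      using ij by (simp add: cis_angle complex_eq_iff t_def x_def algebra_simps)
    with b show "z \<in> unit_rhombus p i j" by (simp only: rhombusI)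
  qed
  then show ?thesis by blast
qed

lemma mem_unit_rhombus:
  assumes "i \<in> {1..n}" "j \<in> {1..n}" "i < j"
  shows "Complex x (- t) \<in> unit_rhombus p i j \<longleftrightarrow> left_side p i j t \<le> x \<and> x \<le> right_side p i j t"
  by (simp add: unit_rhombus_eq[OF assms])

lemma left_less_right:
  assumes "i \<in> {1..n}" "j \<in> {1..n}" "i < j" "- Im p < t" "t < - Im p + fall i + fall j"
  shows "left_side p i j t < right_side p i j t"
proof -
  have d: "slope j - slope i > 0" using slope_less assms by simp
  have "0 < fall i" "0 < fall j" using fall_pos assms by auto
  then have "0 < fall i * (slope j - slope i)" "0 < fall j * (slope j - slope i)" using d by auto
  moreover have "0 < (t + Im p) * (slope j - slope i)" using d assms by simp
  moreover have "0 < (fall i + fall j - (t + Im p)) * (slope j - slope i)" using d assms by simp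
  ultimately show ?thesis
    by (simp add: left_side_def right_side_def algebra_simps)
qed

text \<open>Of the four differences between a line of the minimum and a line of the maximum, two are
  positive constants; the other two change sign exactly at the top and at the bottom vertex.\<close>

lemma left_le_right_iff:
  assumes "i \<in> {1..n}" "j \<in> {1..n}" "i < j"
  shows "left_side p i j t \<le> right_side p i j t \<longleftrightarrow> - Im p \<le> t \<and> t \<le> - Im p + fall i + fall j"
proof -
  have d: "slope j - slope i > 0" using slope_less assms by simp
  have "0 < fall i" "0 < fall j" using fall_pos assms by auto
  then have pos: "0 < fall i * (slope j - slope i)" "0 < fall j * (slope j - slope i)" using d by auto
  have "- Im p \<le> t \<longleftrightarrow> 0 \<le> (t + Im p) * (slope j - slope i)"
    using d by (simp add: zero_le_mult_iff) linarith
  moreover have "t \<le> - Im p + fall i + fall j \<longleftrightarrow> 0 \<le> (fall i + fall j - (t + Im p)) * (slope j - slope i)"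
    using d by (simp add: zero_le_mult_iff) linarith
  ultimately show ?thesis using pos
    by (auto simp add: left_side_def right_side_def algebra_simps)
qed

lemma mem_unit_rhombus_depth:
  assumes "i \<in> {1..n}" "j \<in> {1..n}" "i < j" "z \<in> unit_rhombus p i j"
  shows "- Im p \<le> - Im z" "- Im z \<le> - Im p + fall i + fall j"
  using assms left_le_right_iff[of i j p "- Im z"] by (auto simp: unit_rhombus_eq)

lemma right_side_upper:
  assumes "i \<in> {1..n}" "j \<in> {1..n}" "i < j" "t \<le> - Im p + fall j"
  shows "right_side p i j t = Re p + slope j * (t + Im p)"
proof -
  have "0 \<le> (slope j - slope i) * (fall j - (t + Im p))"
    using slope_less[OF assms(1-3)] assms(4) by simp
  then show ?thesis by (simp add: right_side_def algebra_simps)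
qed

lemma right_side_lower:
  assumes "i \<in> {1..n}" "j \<in> {1..n}" "i < j" "t \<ge> - Im p + fall j"
  shows "right_side p i j t = Re p + slope i * (t + Im p) + fall j * (slope j - slope i)"
proof -
  have "0 \<le> (slope j - slope i) * ((t + Im p) - fall j)"
    using slope_less[OF assms(1-3)] assms(4) by simp
  then show ?thesis by (simp add: right_side_def algebra_simps)
qed

lemma left_side_upper:
  assumes "i \<in> {1..n}" "j \<in> {1..n}" "i < j" "t \<le> - Im p + fall i"
  shows "left_side p i j t = Re p + slope i * (t + Im p)"
proof -
  have "0 \<le> (slope j - slope i) * (fall i - (t + Im p))"
    using slope_less[OF assms(1-3)] assms(4) by simp
  then show ?thesis by (simp add: left_side_def algebra_simps)
qed

lemma left_side_lower:
  assumes "i \<in> {1..n}" "j \<in> {1..n}" "i < j" "t \<ge> - Im p + fall i"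
  shows "left_side p i j t = Re p + slope j * (t + Im p) - fall i * (slope j - slope i)"
proof -
  have "0 \<le> (slope j - slope i) * ((t + Im p) - fall i)"
    using slope_less[OF assms(1-3)] assms(4) by simp
  then show ?thesis by (simp add: left_side_def algebra_simps)
qed

lemma interior_unit_rhombus:
  assumes "i \<in> {1..n}" "j \<in> {1..n}" "i < j"
    "left_side p i j (- Im z) < Re z" "Re z < right_side p i j (- Im z)"
  shows "z \<in> interior (unit_rhombus p i j)"
proof -
  let ?U = "{z. left_side p i j (- Im z) < Re z} \<inter> {z. Re z < right_side p i j (- Im z)}"
  have "open ?U"
    unfolding left_side_def right_side_def by (intro open_Int open_Collect_less continuous_intros)
  moreover have "?U \<subseteq> unit_rhombus p i j" using assms by (auto simp: unit_rhombus_eq)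
  ultimately have "?U \<subseteq> interior (unit_rhombus p i j)" by (rule interior_maximal[rotated])
  with assms show ?thesis by blast
qed

text \<open>A tile contains the points immediately to the left of its right side.\<close>

lemma overlap_at_right_side:
  assumes R: "i \<in> {1..n}" "j \<in> {1..n}" "i < j" and S: "i' \<in> {1..n}" "j' \<in> {1..n}" "i' < j'"
    and "- Im p < t" "t < - Im p + fall i + fall j"
    and "- Im q < t" "t < - Im q + fall i' + fall j'"
    and eq: "right_side p i j t = right_side q i' j' t"
  shows "interior (unit_rhombus p i j) \<inter> interior (unit_rhombus q i' j') \<noteq> {}"
proof -
  have "max (left_side p i j t) (left_side q i' j' t) < right_side p i j t"
    using left_less_right[OF R, of p t] left_less_right[OF S, of q t] assms by simp
  then obtain x where "max (left_side p i j t) (left_side q i' j' t) < x" "x < right_side p i j t"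
    using dense by blast
  then have "Complex x (- t) \<in> interior (unit_rhombus p i j)"
    "Complex x (- t) \<in> interior (unit_rhombus q i' j')"
    using eq by (auto intro!: interior_unit_rhombus R S)
  then show ?thesis by blast
qed

lemma cis_independent:
  assumes "i \<in> {1..n}" "j \<in> {1..n}" "i \<noteq> j"
  shows "(\<i> * cis (\<theta> i)) \<bullet> cis (\<theta> j) \<noteq> 0"
proof -
  have "slope i \<noteq> slope j" using assms slope_inj by blast
  moreover have "(\<i> * cis (\<theta> i)) \<bullet> cis (\<theta> j) = (slope j - slope i) * (fall i * fall j)"
    using assms by (simp add: cis_angle inner_complex_def algebra_simps)
  ultimately show ?thesis using fall_pos[of i] fall_pos[of j] assms by simp
qed

lemma edges_face_of_unit_rhombus:
  assumes "i \<in> {1..n}" "j \<in> {1..n}" "i \<noteq> j"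
  shows "closed_segment p (p + cis (\<theta> i)) face_of unit_rhombus p i j"
    "closed_segment p (p + cis (\<theta> j)) face_of unit_rhombus p i j"
    "closed_segment (p + cis (\<theta> i)) (p + cis (\<theta> i) + cis (\<theta> j)) face_of unit_rhombus p i j"
    "closed_segment (p + cis (\<theta> j)) (p + cis (\<theta> j) + cis (\<theta> i)) face_of unit_rhombus p i j"
proof -
  have ind: "(\<i> * cis (\<theta> i)) \<bullet> cis (\<theta> j) \<noteq> 0" "(\<i> * cis (\<theta> j)) \<bullet> cis (\<theta> i) \<noteq> 0"
    using cis_independent assms by auto
  then have ind': "(\<i> * cis (\<theta> i)) \<bullet> - cis (\<theta> j) \<noteq> 0" "(\<i> * cis (\<theta> j)) \<bullet> - cis (\<theta> i) \<noteq> 0"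
    by (simp_all add: inner_minus_right)
  show "closed_segment p (p + cis (\<theta> i)) face_of unit_rhombus p i j"
    by (rule segment_face_of_rhombus[OF ind(1)])
  show "closed_segment p (p + cis (\<theta> j)) face_of unit_rhombus p i j"
    by (subst rhombus_commute) (rule segment_face_of_rhombus[OF ind(2)])
  show "closed_segment (p + cis (\<theta> j)) (p + cis (\<theta> j) + cis (\<theta> i)) face_of unit_rhombus p i j"
    by (subst rhombus_shift) (rule segment_face_of_rhombus[OF ind'(1)])
  show "closed_segment (p + cis (\<theta> i)) (p + cis (\<theta> i) + cis (\<theta> j)) face_of unit_rhombus p i j"
    by (subst rhombus_commute, subst rhombus_shift) (rule segment_face_of_rhombus[OF ind'(2)])
qed

section \<open>Paths\<close>

definition depth :: "(nat \<Rightarrow> nat) \<Rightarrow> nat \<Rightarrow> real" where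
  "depth u k = (\<Sum>i=1..k. fall (u i))"

text \<open>
  \<open>clip s\<close> is the portion of an edge of vertical extent \<open>s\<close> above a given level, so that
  \<open>weigh f u t\<close> is the integral of \<open>f\<close> over the part of the path \<open>u\<close> above depth \<open>t\<close>.
\<close>

definition clip :: "real \<Rightarrow> real \<Rightarrow> real" where
  "clip s t = max 0 (min s t)"

definition weigh :: "(nat \<Rightarrow> real) \<Rightarrow> (nat \<Rightarrow> nat) \<Rightarrow> real \<Rightarrow> real" where
  "weigh f u t = (\<Sum>i=1..n. f (u i) * clip (fall (u i)) (t - depth u (i - 1)))"

abbreviation abscissa :: "(nat \<Rightarrow> nat) \<Rightarrow> real \<Rightarrow> real" where
  "abscissa \<equiv> weigh slope"

lemma depth_0 [simp]: "depth u 0 = 0"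
  by (simp add: depth_def)

lemma depth_Suc: "depth u (Suc k) = depth u k + fall (u (Suc k))"
  by (simp add: depth_def)

lemma depth_pred: "1 \<le> k \<Longrightarrow> depth u k = depth u (k - 1) + fall (u k)"
  using depth_Suc[of u "k - 1"] by simp

lemma permutes_in: "u permutes {1..n} \<Longrightarrow> 1 \<le> k \<Longrightarrow> k \<le> n \<Longrightarrow> u k \<in> {1..n}"
  by (metis atLeastAtMost_iff permutes_in_image)

lemma depth_less:
  assumes u: "u permutes {1..n}" and "k < l" "l \<le> n"
  shows "depth u k < depth u l"
  using assms(2,3)
proof (induction l)
  case (Suc l)
  then have "depth u k \<le> depth u l" by (cases "k = l") auto
  also have "\<dots> < depth u (Suc l)"
    using fall_pos[OF permutes_in[OF u, of "Suc l"]] Suc.prems by (simp add: depth_Suc)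
  finally show ?case .
qed simp

lemma depth_le:
  assumes "u permutes {1..n}" and "k \<le> l" "l \<le> n"
  shows "depth u k \<le> depth u l"
  using depth_less[OF assms(1), of k l] assms(2,3) by (cases "k = l") auto

lemma depth_le_iff:
  assumes "u permutes {1..n}" and "k \<le> n" "l \<le> n"
  shows "depth u k \<le> depth u l \<longleftrightarrow> k \<le> l"
  using depth_less[OF assms(1), of l k] depth_le[OF assms(1), of k l] assms by (meson leD le_less_linear)

lemma depth_top: "u permutes {1..n} \<Longrightarrow> depth u n = depth id n"
  unfolding depth_def using sum.permute[of u "{1..n}" fall] by (simp add: o_def)

lemma path_vertex_eq:
  assumes u: "u permutes {1..n}" and "k \<le> n"
  shows "path_vertex \<theta> u k = Complex (\<Sum>i=1..k. slope (u i) * fall (u i)) (- depth u k)"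
proof -
  have "path_vertex \<theta> u k = (\<Sum>i=1..k. Complex (slope (u i) * fall (u i)) (- fall (u i)))"
    unfolding path_vertex_def
    by (rule sum.cong[OF refl], rule cis_angle, rule permutes_in[OF u]) (use assms(2) in auto)
  then show ?thesis by (simp add: complex_eq_iff depth_def sum_negf)
qed

lemma Im_path_vertex: "u permutes {1..n} \<Longrightarrow> k \<le> n \<Longrightarrow> Im (path_vertex \<theta> u k) = - depth u k"
  by (simp add: path_vertex_eq)

lemma path_vertex_Suc: "path_vertex \<theta> u (Suc k) = path_vertex \<theta> u k + cis (\<theta> (u (Suc k)))"
  by (simp add: path_vertex_def)

lemma path_vertex_pred: "1 \<le> k \<Longrightarrow> path_vertex \<theta> u k = path_vertex \<theta> u (k - 1) + cis (\<theta> (u k))"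
  using path_vertex_Suc[of u "k - 1"] by simp

lemma weigh_piece:
  assumes u: "u permutes {1..n}" and k: "1 \<le> k" "k \<le> n"
    and t: "depth u (k - 1) \<le> t" "t \<le> depth u k"
  shows "weigh f u t = (\<Sum>i=1..k-1. f (u i) * fall (u i)) + f (u k) * (t - depth u (k - 1))"
proof -
  let ?g = "\<lambda>i. f (u i) * clip (fall (u i)) (t - depth u (i - 1))"
  have split: "{1..n} = {1..k-1} \<union> ({k} \<union> {Suc k..n})" using k by auto
  have "weigh f u t = sum ?g {1..k-1} + (?g k + sum ?g {Suc k..n})"
    unfolding weigh_def split by (subst sum.union_disjoint; auto)+
  also have "sum ?g {1..k-1} = (\<Sum>i=1..k-1. f (u i) * fall (u i))"
  proof (rule sum.cong[OF refl])
    fix i assume i: "i \<in> {1..k-1}"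
    then have "depth u i \<le> depth u (k - 1)" using k by (intro depth_le[OF u]) auto
    then have "fall (u i) \<le> t - depth u (i - 1)" using depth_pred[of i u] i t by simp
    moreover have "fall (u i) > 0" using i k by (intro fall_pos permutes_in[OF u]) auto
    ultimately show "?g i = f (u i) * fall (u i)" by (simp add: clip_def)
  qed
  also have "sum ?g {Suc k..n} = 0"
  proof (rule sum.neutral, rule ballI)
    fix i assume i: "i \<in> {Suc k..n}"
    then have "depth u k \<le> depth u (i - 1)" by (intro depth_le[OF u]) auto
    then show "?g i = 0" using t by (simp add: clip_def)
  qed
  also have "?g k = f (u k) * (t - depth u (k - 1))"
    using t depth_pred[of k u] k by (simp add: clip_def)
  finally show ?thesis by simp
qed

lemma abscissa_piece:
  assumes u: "u permutes {1..n}" and k: "1 \<le> k" "k \<le> n"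
    and t: "depth u (k - 1) \<le> t" "t \<le> depth u k"
  shows "abscissa u t = Re (path_vertex \<theta> u (k - 1)) + slope (u k) * (t - depth u (k - 1))"
  using weigh_piece[OF assms, of slope] k by (simp add: path_vertex_eq[OF u])

lemma abscissa_vertex:
  assumes u: "u permutes {1..n}" and k: "k \<le> n"
  shows "abscissa u (depth u k) = Re (path_vertex \<theta> u k)"
proof (cases "k = 0")
  case True
  have "clip (fall (u i)) (0 - depth u (i - 1)) = 0" if "i \<in> {1..n}" for i
  proof -
    have "depth u 0 \<le> depth u (i - 1)" using that by (intro depth_le[OF u]) auto
    then show ?thesis by (simp add: clip_def min_def)
  qed
  with True show ?thesis by (simp add: weigh_def path_vertex_def)
next
  case False
  then have "depth u k = depth u (k - 1) + fall (u k)" by (intro depth_pred) simp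
  moreover have "fall (u k) > 0" using fall_pos permutes_in[OF u] False k by simp
  ultimately have "abscissa u (depth u k) = Re (path_vertex \<theta> u (k - 1)) + slope (u k) * fall (u k)"
    using abscissa_piece[OF u, of k "depth u k"] False k by simp
  then show ?thesis
    using path_vertex_pred[of k u] cis_angle[OF permutes_in[OF u, of k]] False k by simp
qed

lemma complex_abscissa_vertex:
  "u permutes {1..n} \<Longrightarrow> k \<le> n \<Longrightarrow>
    Complex (abscissa u (depth u k)) (- depth u k) = path_vertex \<theta> u k"
  by (simp add: complex_eq_iff abscissa_vertex Im_path_vertex)

lemma continuous_weigh: "continuous_on A (weigh f u)"
  unfolding weigh_def clip_def by (intro continuous_intros)

lemma exists_piece:
  assumes u: "u permutes {1..n}" and "n \<ge> 1" and t: "0 \<le> t" "t \<le> depth u n"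
  shows "\<exists>k. 1 \<le> k \<and> k \<le> n \<and> depth u (k - 1) \<le> t \<and> t \<le> depth u k"
\<comment> \<open>At \<open>t = 0\<close> the least index with \<open>t \<le> depth u k\<close> is
  0, which is not the index of an edge.\<close>
proof (cases "t = 0")
  case True
  then show ?thesis using assms depth_le[OF u, of 0 1] by (intro exI[of _ 1]) auto
next
  case False
  define k where "k = (LEAST k. t \<le> depth u k)"
  have "t \<le> depth u k" unfolding k_def using t(2) by (rule LeastI)
  moreover have "k \<le> n" unfolding k_def using t(2) by (rule Least_le)
  moreover have "k \<noteq> 0" using \<open>t \<le> depth u k\<close> False t by (intro notI) simp
  moreover have "\<not> t \<le> depth u (k - 1)" using \<open>k \<noteq> 0\<close> unfolding k_def by (intro not_less_Least) simp
  ultimately show ?thesis by (intro exI[of _ k]) auto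
qed

text \<open>This writes a depth as a sum over the clipped edges, so that subtracting a constant
  slope from an abscissa can be done edge by edge.\<close>

lemma weigh_one:
  assumes u: "u permutes {1..n}" and "n \<ge> 1" and t: "0 \<le> t" "t \<le> depth u n"
  shows "weigh (\<lambda>_. 1) u t = t"
proof -
  obtain k where "1 \<le> k" "k \<le> n" "depth u (k - 1) \<le> t" "t \<le> depth u k"
    using exists_piece[OF assms] by blast
  from weigh_piece[OF u this, of "\<lambda>_. 1"] show ?thesis by (simp add: depth_def)
qed

lemma path_edge_eq:
  assumes u: "u permutes {1..n}" and k: "1 \<le> k" "k \<le> n"
  shows "path_edge \<theta> u k = {Complex (abscissa u t) (- t) |t. depth u (k - 1) \<le> t \<and> t \<le> depth u k}"
    (is "_ = ?S")
proof -
  have f: "fall (u k) > 0" using fall_pos permutes_in[OF u] k by simp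
  have dk: "depth u k = depth u (k - 1) + fall (u k)" by (rule depth_pred[OF k(1)])
  have param: "(1 - \<alpha>) *\<^sub>R path_vertex \<theta> u (k - 1) + \<alpha> *\<^sub>R path_vertex \<theta> u k
      = Complex (abscissa u (depth u (k - 1) + \<alpha> * fall (u k))) (- (depth u (k - 1) + \<alpha> * fall (u k)))"
    if "0 \<le> \<alpha>" "\<alpha> \<le> 1" for \<alpha>
  proof -
    have "\<alpha> * fall (u k) \<le> fall (u k)" "0 \<le> \<alpha> * fall (u k)"
      using that f by (simp_all add: mult_left_le_one_le)
    then have "abscissa u (depth u (k - 1) + \<alpha> * fall (u k))
        = Re (path_vertex \<theta> u (k - 1)) + slope (u k) * (\<alpha> * fall (u k))"
      using abscissa_piece[OF u k, of "depth u (k - 1) + \<alpha> * fall (u k)"] dk by simp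
    moreover have "Re (path_vertex \<theta> u k) = Re (path_vertex \<theta> u (k - 1)) + slope (u k) * fall (u k)"
      using cis_angle[OF permutes_in[OF u k]] path_vertex_pred[OF k(1), of u] by simp
    moreover have "Im (path_vertex \<theta> u (k - 1)) = - depth u (k - 1)" "Im (path_vertex \<theta> u k) = - depth u k"
      using k by (auto intro!: Im_path_vertex[OF u])
    ultimately show ?thesis using dk
      by (simp only: complex_eq_iff complex.sel plus_complex.sel scaleR_complex.sel) (simp add: algebra_simps)
  qed
  show ?thesis
  proof (intro equalityI subsetI)
    fix z assume "z \<in> path_edge \<theta> u k"
    then obtain \<alpha> where \<alpha>: "0 \<le> \<alpha>" "\<alpha> \<le> 1"
      and z: "z = (1 - \<alpha>) *\<^sub>R path_vertex \<theta> u (k - 1) + \<alpha> *\<^sub>R path_vertex \<theta> u k"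
      by (auto simp: path_edge_def closed_segment_def)
    have "\<alpha> * fall (u k) \<le> fall (u k)" "0 \<le> \<alpha> * fall (u k)"
      using \<alpha> f by (simp_all add: mult_left_le_one_le)
    with z show "z \<in> ?S" unfolding z param[OF \<alpha>] using dk by auto
  next
    fix z assume "z \<in> ?S"
    then obtain t where t: "depth u (k - 1) \<le> t" "t \<le> depth u k" and z: "z = Complex (abscissa u t) (- t)"
      by blast
    define \<alpha> where "\<alpha> = (t - depth u (k - 1)) / fall (u k)"
    have \<alpha>: "0 \<le> \<alpha>" "\<alpha> \<le> 1" "depth u (k - 1) + \<alpha> * fall (u k) = t"
      using f t dk by (simp_all add: \<alpha>_def)
    show "z \<in> path_edge \<theta> u k"
      using param[OF \<alpha>(1,2)] \<alpha>(1,2) unfolding path_edge_def closed_segment_def z \<alpha>(3) by force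
  qed
qed

lemma path_edge_mem:
  assumes "u permutes {1..n}" "1 \<le> k" "k \<le> n" "depth u (k - 1) \<le> t" "t \<le> depth u k"
  shows "Complex (abscissa u t) (- t) \<in> path_edge \<theta> u k"
  using assms by (auto simp: path_edge_eq)

section \<open>Exchanging two consecutive edges\<close>

definition swap_at :: "(nat \<Rightarrow> nat) \<Rightarrow> nat \<Rightarrow> (nat \<Rightarrow> nat)" where
  "swap_at u k = u \<circ> Transposition.transpose k (Suc k)"

lemma swap_at_simps [simp]:
  "swap_at u k k = u (Suc k)" "swap_at u k (Suc k) = u k"
  "i \<noteq> k \<Longrightarrow> i \<noteq> Suc k \<Longrightarrow> swap_at u k i = u i"
  by (simp_all add: swap_at_def transpose_apply_other)

lemma swap_at_permutes:
  assumes "u permutes {1..n}" "1 \<le> k" "k < n"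
  shows "swap_at u k permutes {1..n}"
  unfolding swap_at_def using assms by (intro permutes_compose[OF permutes_swap_id]) auto

text \<open>An initial segment of length \<open>l \<noteq> k\<close> contains both exchanged
  positions or neither.\<close>

lemma sum_swap_at:
  assumes "1 \<le> k" "l \<noteq> k"
  shows "(\<Sum>i=1..l. f (swap_at u k i)) = (\<Sum>i=1..l. f (u i))"
proof (cases "l < k")
  case True
  then show ?thesis by (intro sum.cong) auto
next
  case False
  then have "Transposition.transpose k (Suc k) permutes {1..l}" using assms by (intro permutes_swap_id) auto
  from sum.permute[OF this, of "\<lambda>i. f (u i)"] show ?thesis by (simp add: swap_at_def o_def)
qed

lemma depth_swap_at: "1 \<le> k \<Longrightarrow> l \<noteq> k \<Longrightarrow> depth (swap_at u k) l = depth u l"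
  unfolding depth_def by (rule sum_swap_at)

lemma path_vertex_swap_at: "1 \<le> k \<Longrightarrow> l \<noteq> k \<Longrightarrow> path_vertex \<theta> (swap_at u k) l = path_vertex \<theta> u l"
  unfolding path_vertex_def by (rule sum_swap_at[where f = "\<lambda>i. cis (\<theta> i)"])

lemma path_edge_swap_at:
  "1 \<le> k \<Longrightarrow> 1 \<le> l \<Longrightarrow> l \<noteq> k \<Longrightarrow> l \<noteq> Suc k \<Longrightarrow> path_edge \<theta> (swap_at u k) l = path_edge \<theta> u l"
  unfolding path_edge_def by (simp add: path_vertex_swap_at)

text \<open>Only the terms of the two exchanged edges can differ. Above these edges both clipped
  portions are empty, below them both are complete, in either order.\<close>

lemma abscissa_swap_at_outside:
  assumes u: "u permutes {1..n}" and k: "1 \<le> k" "k < n"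
    and t: "t \<le> depth u (k - 1) \<or> depth u (Suc k) \<le> t"
  shows "abscissa (swap_at u k) t = abscissa u t"
proof -
  let ?v = "swap_at u k"
  let ?g = "\<lambda>u i. slope (u i) * clip (fall (u i)) (t - depth u (i - 1))"
  have sub: "{k, Suc k} \<subseteq> {1..n}" using k by auto
  have split: "sum (?g x) {1..n} = sum (?g x) ({1..n} - {k, Suc k}) + (?g x k + ?g x (Suc k))" for x
    using sum.subset_diff[OF sub, of "?g x"] by simp
  have "sum (?g ?v) ({1..n} - {k, Suc k}) = sum (?g u) ({1..n} - {k, Suc k})"
    using k by (intro sum.cong refl) (auto simp: depth_swap_at)
  moreover have "?g ?v k + ?g ?v (Suc k) = ?g u k + ?g u (Suc k)"
  proof -
    have f: "fall (u k) > 0" "fall (u (Suc k)) > 0" using permutes_in[OF u] k by (auto intro!: fall_pos)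
    have "depth ?v k = depth u (k - 1) + fall (u (Suc k))"
      using depth_pred[OF k(1), of ?v] k by (simp add: depth_swap_at)
    then show ?thesis
      using t f depth_pred[OF k(1), of u] k
      by (auto simp: clip_def depth_Suc depth_swap_at)
  qed
  ultimately show ?thesis unfolding weigh_def split by simp
qed

text \<open>At a descent the smaller label \<open>u (Suc k)\<close> comes first, as
  \<open>left_side\<close> and \<open>right_side\<close> expect: the right side of the tile consists
  of the edges \<open>k\<close> and \<open>Suc k\<close> of \<open>u\<close>, its left side of those
  of \<open>swap_at u k\<close>.\<close>

definition tile_at :: "(nat \<Rightarrow> nat) \<Rightarrow> nat \<Rightarrow> complex set" where
  "tile_at u k = unit_rhombus (path_vertex \<theta> u (k - 1)) (u (Suc k)) (u k)"

lemma right_side_tile_at: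
  assumes u: "u permutes {1..n}" and k: "1 \<le> k" "k < n" "u (Suc k) < u k"
    and t: "depth u (k - 1) \<le> t" "t \<le> depth u (Suc k)"
  shows "right_side (path_vertex \<theta> u (k - 1)) (u (Suc k)) (u k) t = abscissa u t"
proof -
  let ?p = "path_vertex \<theta> u (k - 1)"
  have ij: "u (Suc k) \<in> {1..n}" "u k \<in> {1..n}" using permutes_in[OF u] k by auto
  have Im: "Im ?p = - depth u (k - 1)" using k by (intro Im_path_vertex[OF u]) simp
  have dk: "depth u k = depth u (k - 1) + fall (u k)" by (rule depth_pred[OF k(1)])
  show ?thesis
  proof (cases "t \<le> depth u k")
    case True
    then show ?thesis
      using right_side_upper[OF ij k(3), of t ?p] abscissa_piece[OF u k(1), of t] k t Im dk
      by simp
  next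
    case False
    have "Re (path_vertex \<theta> u k) = Re ?p + slope (u k) * fall (u k)"
      using path_vertex_pred[OF k(1), of u] cis_angle[OF ij(2)] by simp
    moreover have "abscissa u t = Re (path_vertex \<theta> u k) + slope (u (Suc k)) * (t - depth u k)"
      using abscissa_piece[OF u, of "Suc k" t] False k t by simp
    ultimately show ?thesis
      using right_side_lower[OF ij k(3), of ?p t] False Im dk
      by (simp add: algebra_simps)
  qed
qed

lemma left_side_tile_at:
  assumes u: "u permutes {1..n}" and k: "1 \<le> k" "k < n" "u (Suc k) < u k"
    and t: "depth u (k - 1) \<le> t" "t \<le> depth u (Suc k)"
  shows "left_side (path_vertex \<theta> u (k - 1)) (u (Suc k)) (u k) t = abscissa (swap_at u k) t"
proof -
  let ?p = "path_vertex \<theta> u (k - 1)" and ?v = "swap_at u k"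
  have v: "?v permutes {1..n}" by (rule swap_at_permutes[OF u k(1,2)])
  have ij: "u (Suc k) \<in> {1..n}" "u k \<in> {1..n}" using permutes_in[OF u] k by auto
  have Im: "Im ?p = - depth u (k - 1)" using k by (intro Im_path_vertex[OF u]) simp
  have same: "depth ?v (k - 1) = depth u (k - 1)" "path_vertex \<theta> ?v (k - 1) = ?p"
    "depth ?v (Suc k) = depth u (Suc k)"
    using k by (simp_all add: depth_swap_at path_vertex_swap_at)
  have dk: "depth ?v k = depth u (k - 1) + fall (u (Suc k))"
    using depth_pred[OF k(1), of ?v] same by simp
  show ?thesis
  proof (cases "t \<le> depth ?v k")
    case True
    then show ?thesis
      using left_side_upper[OF ij k(3), of t ?p] abscissa_piece[OF v k(1), of t] k t Im dk same
      by simp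
  next
    case False
    have "Re (path_vertex \<theta> ?v k) = Re ?p + slope (u (Suc k)) * fall (u (Suc k))"
      using path_vertex_pred[OF k(1), of ?v] cis_angle[OF ij(1)] same by simp
    moreover have "abscissa ?v t = Re (path_vertex \<theta> ?v k) + slope (u k) * (t - depth ?v k)"
      using abscissa_piece[OF v, of "Suc k" t] False k t same by simp
    ultimately show ?thesis
      using left_side_lower[OF ij k(3), of ?p t] False Im dk
      by (simp add: algebra_simps)
  qed
qed

lemma mem_tile_at:
  assumes u: "u permutes {1..n}" and k: "1 \<le> k" "k < n" "u (Suc k) < u k"
  shows "Complex x (- t) \<in> tile_at u k \<longleftrightarrow> depth u (k - 1) \<le> t \<and> t \<le> depth u (Suc k) \<and>
    abscissa (swap_at u k) t \<le> x \<and> x \<le> abscissa u t"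
proof -
  let ?p = "path_vertex \<theta> u (k - 1)"
  have ij: "u (Suc k) \<in> {1..n}" "u k \<in> {1..n}" using permutes_in[OF u] k by auto
  have Im: "Im ?p = - depth u (k - 1)" using k by (intro Im_path_vertex[OF u]) simp
  have "depth u (Suc k) = depth u (k - 1) + fall (u k) + fall (u (Suc k))"
    using depth_pred[OF k(1), of u] by (simp add: depth_Suc)
  then have outside: "Complex x (- t) \<notin> tile_at u k" if "\<not> (depth u (k - 1) \<le> t \<and> t \<le> depth u (Suc k))"
    using that mem_unit_rhombus_depth[OF ij k(3), of "Complex x (- t)" ?p] Im
    by (auto simp: tile_at_def)
  have "Complex x (- t) \<in> tile_at u k \<longleftrightarrow> abscissa (swap_at u k) t \<le> x \<and> x \<le> abscissa u t"
    if "depth u (k - 1) \<le> t" "t \<le> depth u (Suc k)"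
    unfolding tile_at_def mem_unit_rhombus[OF ij k(3)]
      right_side_tile_at[OF assms that] left_side_tile_at[OF assms that] by (rule refl)
  with outside show ?thesis by blast
qed

lemma abscissa_swap_at_le:
  assumes u: "u permutes {1..n}" and k: "1 \<le> k" "k < n" "u (Suc k) < u k"
  shows "abscissa (swap_at u k) t \<le> abscissa u t"
proof (cases "depth u (k - 1) \<le> t \<and> t \<le> depth u (Suc k)")
  case True
  let ?p = "path_vertex \<theta> u (k - 1)"
  have ij: "u (Suc k) \<in> {1..n}" "u k \<in> {1..n}" using permutes_in[OF u] k by auto
  have Im: "Im ?p = - depth u (k - 1)" using k by (intro Im_path_vertex[OF u]) simp
  have "depth u (Suc k) = depth u (k - 1) + fall (u k) + fall (u (Suc k))"
    using depth_pred[OF k(1), of u] by (simp add: depth_Suc)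
  then show ?thesis
    using right_side_tile_at[OF assms, of t] left_side_tile_at[OF assms, of t] True
      left_le_right_iff[OF ij k(3), of ?p t] Im by auto
next
  case False
  then show ?thesis using abscissa_swap_at_outside[OF u k(1,2), of t] by auto
qed

lemma abscissa_swap_at_less:
  assumes u: "u permutes {1..n}" and k: "1 \<le> k" "k < n" "u (Suc k) < u k"
    and t: "depth u (k - 1) < t" "t < depth u (Suc k)"
  shows "abscissa (swap_at u k) t < abscissa u t"
proof -
  let ?p = "path_vertex \<theta> u (k - 1)"
  have ij: "u (Suc k) \<in> {1..n}" "u k \<in> {1..n}" using permutes_in[OF u] k by auto
  have Im: "Im ?p = - depth u (k - 1)" using k by (intro Im_path_vertex[OF u]) simp
  have "depth u (Suc k) = depth u (k - 1) + fall (u k) + fall (u (Suc k))"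
    using depth_pred[OF k(1), of u] by (simp add: depth_Suc)
  then show ?thesis
    using right_side_tile_at[OF assms(1-4), of t] left_side_tile_at[OF assms(1-4), of t] t
      left_less_right[OF ij k(3), of ?p t] Im by auto
qed

text \<open>Bubble sort as an induction rule: exchanging a descent increases the sum of
  \<open>i * u i\<close> by \<open>u k - u (Suc k)\<close>, and this sum is bounded by the cube of
  \<open>n\<close>.\<close>

lemma bubble_induct [consumes 1, case_names id swap]:
  assumes "u permutes {1..n}" and "P id"
    and step: "\<And>u k. u permutes {1..n} \<Longrightarrow> 1 \<le> k \<Longrightarrow> k < n \<Longrightarrow> u (Suc k) < u k \<Longrightarrow>
      P (swap_at u k) \<Longrightarrow> P u"
  shows "P u"
  using assms(1)
proof (induction "n * (n * n) - (\<Sum>i=1..n. i * u i)" arbitrary: u rule: less_induct)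
  case less
  show ?case
  proof (cases "\<exists>k. 1 \<le> k \<and> k < n \<and> u (Suc k) < u k")
    case True
    then obtain k where k: "1 \<le> k" "k < n" "u (Suc k) < u k" by blast
    let ?v = "swap_at u k"
    have v: "?v permutes {1..n}" by (rule swap_at_permutes[OF less.prems k(1,2)])
    have sub: "{k, Suc k} \<subseteq> {1..n}" using k by auto
    have split: "(\<Sum>i=1..n. i * x i) = (\<Sum>i\<in>{1..n} - {k, Suc k}. i * x i) + (k * x k + Suc k * x (Suc k))"
      for x using sum.subset_diff[OF sub, of "\<lambda>i. i * x i"] by simp
    have "(\<Sum>i\<in>{1..n} - {k, Suc k}. i * ?v i) = (\<Sum>i\<in>{1..n} - {k, Suc k}. i * u i)"
      by (intro sum.cong) auto
    then have "(\<Sum>i=1..n. i * u i) < (\<Sum>i=1..n. i * ?v i)"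
      unfolding split using k(3) by simp
    moreover have "(\<Sum>i=1..n. i * ?v i) \<le> n * (n * n)"
      using sum_bounded_above[of "{1..n}" "\<lambda>i. i * ?v i" "n * n"] permutes_in[OF v]
      by (simp add: mult_le_mono)
    ultimately show ?thesis using step[OF less.prems k] less.hyps[of ?v] v by simp
  next
    case False
    have inj: "inj u" using less.prems by (rule permutes_inj)
    \<comment> \<open>Without descents \<open>u\<close> is strictly increasing, hence dominates the
      identity, and the only permutation doing so is the identity itself.\<close>
    have "i \<le> u i" if "1 \<le> i" "i \<le> n" for i
      using that
    proof (induction i rule: dec_induct)
      case base
      then show ?case using permutes_in[OF less.prems, of 1] by simp
    next
      case (step i)
      moreover have "u (Suc i) \<noteq> u i" using inj by (simp add: inj_eq)
      ultimately have "u i < u (Suc i)" using False by (metis Suc_le_eq linorder_neqE_nat)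
      with step show ?case by simp
    qed
    then have "u = id" by (intro permutes_natset_ge[OF less.prems]) auto
    with assms(2) show ?thesis by simp
  qed
qed

lemma abscissa_id_le:
  assumes "u permutes {1..n}"
  shows "abscissa id t \<le> abscissa u t"
  using assms
proof (induction rule: bubble_induct)
  case (swap u k)
  then show ?case using abscissa_swap_at_le[of u k t] by simp
qed simp

section \<open>The polygon\<close>

lemma clip_bounds: "0 \<le> s \<Longrightarrow> 0 \<le> clip s t" "0 \<le> s \<Longrightarrow> clip s t \<le> s"
  by (simp_all add: clip_def)

text \<open>
  Subtracting the slope \<open>slope c\<close> of the left path at depth \<open>t\<close>, the left path collects exactly
  the negative contributions above depth \<open>t\<close>. Another path touching it there uses the same
  portions of all labels different from \<open>c\<close>, hence starts with an initial segment of labels.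
\<close>

lemma fully_supported_abscissa_less:
  assumes w: "w permutes {1..n}" and fs: "fully_supported n w" and n: "n \<ge> 2"
    and t: "0 < t" "t < depth id n"
  shows "abscissa id t < abscissa w t"
proof (rule ccontr)
  assume "\<not> abscissa id t < abscissa w t"
  then have touch: "abscissa w t = abscissa id t" using abscissa_id_le[OF w, of t] by simp
  have idp: "id permutes {1..n}" by (rule permutes_id)
  have top: "depth w n = depth id n" by (rule depth_top[OF w])
  obtain c where c: "1 \<le> c" "c \<le> n" "depth id (c - 1) \<le> t" "t \<le> depth id c"
    using exists_piece[OF idp _ less_imp_le[OF t(1)] less_imp_le[OF t(2)]] n by auto
  define lo where "lo j = (if j < c then (slope j - slope c) * fall j else 0)" for j
  define part where "part u i = (slope (u i) - slope c) * clip (fall (u i)) (t - depth u (i - 1))" for u i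
  have total: "(\<Sum>i=1..n. part u i) = abscissa u t - slope c * t" if u: "u permutes {1..n}" for u
  proof -
    have "(\<Sum>i=1..n. part u i) = abscissa u t - slope c * weigh (\<lambda>_. 1) u t"
      by (simp add: part_def weigh_def sum_distrib_left left_diff_distrib sum_subtractf mult.assoc)
    then show ?thesis using weigh_one[OF u] t n by (simp add: depth_top[OF u])
  qed
  have ge: "lo (w i) \<le> part w i" if i: "i \<in> {1..n}" for i
  proof -
    have wi: "w i \<in> {1..n}" using permutes_in[OF w] i by simp
    have f: "fall (w i) > 0" by (rule fall_pos[OF wi])
    consider "w i < c" | "w i = c" | "w i > c" by linarith
    then show ?thesis
    proof cases
      case 1
      then have "slope (w i) - slope c < 0" using slope_less[OF wi, of c] c by simp
      then show ?thesis
        using 1 clip_bounds(2)[of "fall (w i)"] f by (simp add: lo_def part_def mult_left_mono_neg)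
    next
      case 3
      then have "slope (w i) - slope c > 0" using slope_less[OF _ wi, of c] c by simp
      then show ?thesis using 3 clip_bounds(1)[of "fall (w i)"] f by (simp add: lo_def part_def)
    qed (simp add: lo_def part_def)
  qed
  have "part id i = lo i" if i: "i \<in> {1..n}" for i
  proof -
    have f: "fall i > 0" by (rule fall_pos[OF i])
    have di: "depth id i = depth id (i - 1) + fall i" using depth_pred[of i id] i by simp
    consider "i < c" | "i = c" | "i > c" by linarith
    then show ?thesis
    proof cases
      case 1
      then have "depth id i \<le> depth id (c - 1)" using c by (intro depth_le[OF idp]) auto
      then have "clip (fall i) (t - depth id (i - 1)) = fall i" using c di f by (simp add: clip_def)
      then show ?thesis using 1 by (simp add: lo_def part_def)
    next
      case 3
      then have "depth id c \<le> depth id (i - 1)" using i by (intro depth_le[OF idp]) auto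
      then have "clip (fall i) (t - depth id (i - 1)) = 0" using c f by (simp add: clip_def)
      then show ?thesis using 3 by (simp add: lo_def part_def)
    qed (simp add: lo_def part_def)
  qed
  then have "sum lo {1..n} = abscissa id t - slope c * t"
    using total[OF idp] by simp
  moreover have "(\<Sum>i=1..n. lo (w i)) = sum lo {1..n}"
    using sum.permute[OF w, of lo] by (simp add: o_def)
  ultimately have "(\<Sum>i=1..n. lo (w i)) = (\<Sum>i=1..n. part w i)"
    using total[OF w] touch by simp
  \<comment> \<open>The sums agree and the terms are ordered, so every single term is an equality.
    For labels other than \<open>c\<close> the factor \<open>slope (w i) - slope c\<close> is
    nonzero and can be cancelled below: smaller labels lie wholly above depth \<open>t\<close>,
    larger ones wholly below.\<close>
  then have eq: "lo (w i) = part w i" if "i \<in> {1..n}" for i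
    using sum_mono_inv[of "\<lambda>i. lo (w i)" "{1..n}" "part w"] ge that by blast
  have small: "depth w i \<le> t" if i: "1 \<le> i" "i \<le> n" "w i < c" for i
  proof -
    have wi: "w i \<in> {1..n}" using permutes_in[OF w] i by simp
    have "slope (w i) < slope c" using slope_less[OF wi, of c] c i by simp
    then have "clip (fall (w i)) (t - depth w (i - 1)) = fall (w i)"
      using eq[of i] i by (simp add: lo_def part_def)
    then show ?thesis using fall_pos[OF wi] depth_pred[OF i(1), of w] by (simp add: clip_def max_def min_def split: if_splits)
  qed
  have large: "t \<le> depth w (i - 1)" if i: "1 \<le> i" "i \<le> n" "c < w i" for i
  proof -
    have wi: "w i \<in> {1..n}" using permutes_in[OF w] i by simp
    have "slope c < slope (w i)" using slope_less[OF _ wi, of c] c i by simp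
    then have "clip (fall (w i)) (t - depth w (i - 1)) = 0"
      using eq[of i] i by (simp add: lo_def part_def)
    then show ?thesis using fall_pos[OF wi] by (simp add: clip_def max_def min_def split: if_splits)
  qed
  \<comment> \<open>\<open>l\<close> counts the edges of \<open>w\<close> that end at or above depth
    \<open>t\<close>; edge \<open>Suc l\<close> ends strictly below it.\<close>
  define l where "l = (LEAST k. t < depth w (Suc k))"
  have lt: "t < depth w (Suc l)" unfolding l_def
    by (rule LeastI[of _ "n - 1"]) (use t top n in simp)
  have "l \<le> n - 1" unfolding l_def by (rule Least_le) (use t top n in simp)
  then have ln: "l < n" using n by simp
  have le: "depth w l \<le> t"
  proof (cases l)
    case (Suc k)
    then have "\<not> t < depth w (Suc k)" unfolding l_def by (metis lessI not_less_Least)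
    with Suc show ?thesis by simp
  qed (use t in simp)
  have low: "w i \<le> c" if "1 \<le> i" "i \<le> l" for i
  proof (rule ccontr)
    assume "\<not> w i \<le> c"
    then have "t \<le> depth w (i - 1)" using large[of i] that ln by simp
    also have "\<dots> < depth w l" using that ln by (intro depth_less[OF w]) auto
    finally show False using le by simp
  qed
  have high: "c \<le> w i" if "l < i" "i \<le> n" for i
  proof (rule ccontr)
    assume "\<not> c \<le> w i"
    then have "depth w i \<le> t" using small[of i] that by simp
    moreover have "depth w (Suc l) \<le> depth w i" using that by (intro depth_le[OF w]) auto
    ultimately show False using lt by simp
  qed
  have surj: "\<exists>i. 1 \<le> i \<and> i \<le> n \<and> w i = j" if "1 \<le> j" "j \<le> n" for j
    using permutes_image[OF w] that by (metis atLeastAtMost_iff imageE)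
  obtain k where k: "1 \<le> k" "k \<le> n" "w k = c" using surj c by blast
  have inj: "inj w" using w by (rule permutes_inj)
  \<comment> \<open>The label \<open>c\<close> itself may stand on either side of depth
    \<open>t\<close>, which decides whether it belongs to the initial segment of labels.\<close>
  define r where "r = (if k \<le> l then c else c - 1)"
  have img: "w ` {1..l} = {1..r}"
  proof (intro equalityI subsetI)
    fix j assume "j \<in> w ` {1..l}"
    then obtain i where i: "1 \<le> i" "i \<le> l" "j = w i" by auto
    then have "1 \<le> j" "j \<le> c" using permutes_in[OF w, of i] low ln by auto
    moreover have "j = c \<Longrightarrow> k \<le> l" using i k inj by (auto simp: inj_eq)
    ultimately show "j \<in> {1..r}" by (cases "j = c") (auto simp: r_def)
  next
    fix j assume j: "j \<in> {1..r}"
    then have "j \<le> c" by (auto simp: r_def split: if_splits)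
    then obtain i where i: "1 \<le> i" "i \<le> n" "w i = j" using surj[of j] j c by auto
    have "i \<le> l"
    proof (rule ccontr)
      assume "\<not> i \<le> l"
      with high[of i] i \<open>j \<le> c\<close> have "j = c" by simp
      with i k inj have "i = k" by (auto simp: inj_eq)
      with \<open>j = c\<close> \<open>\<not> i \<le> l\<close> j c show False by (simp add: r_def)
    qed
    with i show "j \<in> w ` {1..l}" by auto
  qed
  have "card (w ` {1..l}) = l" using card_image[of w "{1..l}"] inj by (simp add: inj_on_subset)
  then have "r = l" using img by simp
  show False
  proof (cases "l = 0")
    case False
    then show False using fs img \<open>r = l\<close> ln by (simp add: fully_supported_def)
  next
    \<comment> \<open>Here the initial segment is empty and says nothing about full support. But
      then \<open>c = 1\<close>, and a first label other than 1 could not begin above depth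
      \<open>t\<close>; so the segment of length 1 is fixed instead.\<close>
    case True
    then have "c = 1" using \<open>r = l\<close> c by (auto simp: r_def split: if_splits)
    have "w 1 = 1"
    proof (rule ccontr)
      assume "w 1 \<noteq> 1"
      then have "c < w 1" using \<open>c = 1\<close> permutes_in[OF w, of 1] n by simp
      then show False using large[of 1] n t by simp
    qed
    then have "w ` {1..1} = {1..1}" by simp
    moreover have "w ` {1..1} \<noteq> {1..1}"
      using fs n unfolding fully_supported_def by (metis le_refl one_less_numeral_iff order_less_le_trans semiring_norm(76))
    ultimately show False by simp
  qed
qed

definition region :: "(nat \<Rightarrow> nat) \<Rightarrow> complex set" where
  "region u = {z. 0 \<le> - Im z \<and> - Im z \<le> depth id n \<and>
     abscissa id (- Im z) \<le> Re z \<and> Re z \<le> abscissa u (- Im z)}"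

definition open_region :: "(nat \<Rightarrow> nat) \<Rightarrow> complex set" where
  "open_region u = {z. 0 < - Im z \<and> - Im z < depth id n \<and>
     abscissa id (- Im z) < Re z \<and> Re z < abscissa u (- Im z)}"

lemma continuous_abscissa_Im: "continuous_on A (\<lambda>z. abscissa u (- Im z))"
  by (rule continuous_on_compose2[OF continuous_weigh[of UNIV]]) (auto intro!: continuous_intros)

lemma closed_region: "closed (region u)"
  unfolding region_def by (intro closed_Collect_conj closed_Collect_le continuous_abscissa_Im continuous_intros)

lemma open_open_region: "open (open_region u)"
  unfolding open_region_def
  by (intro open_Collect_conj open_Collect_less continuous_abscissa_Im continuous_intros)

lemma open_region_subset: "open_region u \<subseteq> region u"
  by (auto simp: region_def open_region_def)

lemma bounded_region: "bounded (region u)"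
proof -
  have bd: "\<exists>M. \<forall>t\<in>{0..depth id n}. \<bar>abscissa v t\<bar> \<le> M" for v
  proof -
    have "compact (abscissa v ` {0..depth id n})"
      by (intro compact_continuous_image continuous_weigh) auto
    then have "bounded (abscissa v ` {0..depth id n})" by (rule compact_imp_bounded)
    then show ?thesis by (auto simp: bounded_iff)
  qed
  obtain A where A: "\<And>t. t \<in> {0..depth id n} \<Longrightarrow> \<bar>abscissa id t\<bar> \<le> A" using bd by blast
  obtain B where B: "\<And>t. t \<in> {0..depth id n} \<Longrightarrow> \<bar>abscissa u t\<bar> \<le> B" using bd by blast
  have "region u \<subseteq> cbox (Complex (- A) (- depth id n)) (Complex B 0)"
  proof
    fix z assume z: "z \<in> region u"
    then have "- Im z \<in> {0..depth id n}" by (simp add: region_def)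
    from A[OF this] B[OF this] z show "z \<in> cbox (Complex (- A) (- depth id n)) (Complex B 0)"
      by (auto simp: in_cbox_complex_iff region_def abs_le_iff)
  qed
  then show ?thesis by (rule bounded_subset[OF bounded_cbox])
qed

lemma abscissa_ends:
  assumes u: "u permutes {1..n}"
  shows "abscissa u 0 = abscissa id 0" "abscissa u (depth id n) = abscissa id (depth id n)"
proof -
  have idp: "id permutes {1..n}" by (rule permutes_id)
  show "abscissa u 0 = abscissa id 0"
    using abscissa_vertex[OF u, of 0] abscissa_vertex[OF idp, of 0] by (simp add: path_vertex_def)
  have "Re (path_vertex \<theta> u n) = Re (path_vertex \<theta> id n)"
    using sum.permute[OF u, of "\<lambda>i. slope i * fall i"]
    by (simp add: path_vertex_eq[OF u] path_vertex_eq[OF idp] o_def)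
  then show "abscissa u (depth id n) = abscissa id (depth id n)"
    using abscissa_vertex[OF u, of n] abscissa_vertex[OF idp, of n] depth_top[OF u] by simp
qed

lemma path_union:
  assumes u: "u permutes {1..n}" and "n \<ge> 1"
  shows "(\<Union>k\<in>{1..n}. path_edge \<theta> u k)
    = {z. 0 \<le> - Im z \<and> - Im z \<le> depth id n \<and> Re z = abscissa u (- Im z)}" (is "?L = ?R")
proof (intro equalityI subsetI)
  fix z assume "z \<in> ?L"
  then obtain k where k: "1 \<le> k" "k \<le> n" "z \<in> path_edge \<theta> u k" by auto
  then obtain t where t: "depth u (k - 1) \<le> t" "t \<le> depth u k" "z = Complex (abscissa u t) (- t)"
    using path_edge_eq[OF u] by auto
  moreover have "depth u 0 \<le> depth u (k - 1)" "depth u k \<le> depth u n"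
    using k by (intro depth_le[OF u]; simp)+
  ultimately show "z \<in> ?R" using depth_top[OF u] by simp
next
  fix z assume z: "z \<in> ?R"
  then obtain k where k: "1 \<le> k" "k \<le> n" "depth u (k - 1) \<le> - Im z" "- Im z \<le> depth u k"
    using exists_piece[OF u assms(2), of "- Im z"] depth_top[OF u] by auto
  then have "Complex (abscissa u (- Im z)) (- (- Im z)) \<in> path_edge \<theta> u k"
    by (intro path_edge_mem[OF u])
  moreover have "Complex (abscissa u (- Im z)) (- (- Im z)) = z" using z by (simp add: complex_eq_iff)
  ultimately show "z \<in> ?L" using k by auto
qed

text \<open>The ray is a connected unbounded set in the complement of \<open>B\<close>, so the
  component of \<open>z\<close> is unbounded. The sign \<sigma> selects the ray to the right or to
  the left.\<close>

lemma not_inside_of_ray: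
  assumes ray: "\<And>s. 0 \<le> s \<Longrightarrow> z + complex_of_real (\<sigma> * s) \<notin> B" and \<sigma>: "\<bar>\<sigma>\<bar> = 1"
  shows "z \<notin> inside B"
proof
  assume "z \<in> inside B"
  then have "bounded (connected_component_set (- B) z)" by (simp add: inside_def)
  then obtain M where M: "\<And>x. x \<in> connected_component_set (- B) z \<Longrightarrow> norm x \<le> M"
    by (auto simp: bounded_iff)
  let ?r = "(\<lambda>s. z + complex_of_real (\<sigma> * s)) ` {0..}"
  have "connected ?r"
    by (intro connected_continuous_image continuous_intros) (simp add: convex_connected)
  moreover have "z \<in> ?r" by (rule image_eqI[of _ _ 0]) auto
  moreover have "?r \<subseteq> - B" using ray by auto
  ultimately have sub: "?r \<subseteq> connected_component_set (- B) z"
    by (intro connected_component_maximal)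
  define s where "s = \<bar>M\<bar> + norm z + 1"
  have s: "0 \<le> s" by (simp add: s_def)
  have "norm (z + complex_of_real (\<sigma> * s)) \<le> M" using M sub s by auto
  moreover have "norm (complex_of_real (\<sigma> * s)) = s"
    unfolding norm_of_real using \<sigma> s by (simp add: abs_mult)
  moreover have "norm (complex_of_real (\<sigma> * s)) \<le> norm (z + complex_of_real (\<sigma> * s)) + norm z"
    by (metis add.commute add_diff_cancel_left' norm_triangle_ineq4)
  ultimately show False unfolding s_def by linarith
qed

text \<open>The frontier of the bounded open region lies in the boundary curve, so no component of
  the complement of the curve can leave that region. From a point outside \<open>region u\<close> a
  horizontal ray escapes: to the left if the point is left of the left path, to the right otherwise.
  The argument also allows paths that touch.\<close>

lemma elnitsky_polygon_eq:
  assumes u: "u permutes {1..n}" and n: "n \<ge> 1"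
  shows "elnitsky_polygon n \<theta> u = region u"
proof -
  define B where "B = elnitsky_boundary n \<theta> u"
  have B: "B = {z. 0 \<le> - Im z \<and> - Im z \<le> depth id n \<and>
      (Re z = abscissa id (- Im z) \<or> Re z = abscissa u (- Im z))}"
    using path_union[OF u n] path_union[OF permutes_id n]
    by (auto simp: B_def elnitsky_boundary_def)
  have BR: "B \<subseteq> region u" using abscissa_id_le[OF u] by (auto simp: B region_def)
  have RB: "region u - open_region u \<subseteq> B"
  proof
    fix z assume z: "z \<in> region u - open_region u"
    then consider "- Im z = 0" | "- Im z = depth id n" | "Re z = abscissa id (- Im z)"
      | "Re z = abscissa u (- Im z)" by (force simp: region_def open_region_def)
    then show "z \<in> B"
    proof cases
      case 1
      then show ?thesis using z abscissa_ends(1)[OF u] by (auto simp: B region_def)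
    next
      case 2
      then show ?thesis using z abscissa_ends(2)[OF u] by (auto simp: B region_def)
    qed (use z in \<open>auto simp: B region_def\<close>)
  qed
  have "open_region u \<subseteq> inside B"
  proof
    fix z assume z: "z \<in> open_region u"
    have zB: "z \<notin> B" using z by (auto simp: B open_region_def)
    let ?C = "connected_component_set (- B) z"
    have "closure (open_region u) \<subseteq> region u"
      by (intro closure_minimal open_region_subset closed_region)
    then have fr: "frontier (open_region u) \<subseteq> B"
      using RB by (auto simp: frontier_def interior_open[OF open_open_region])
    have "?C \<subseteq> open_region u"
    proof (rule ccontr)
      assume "\<not> ?C \<subseteq> open_region u"
      moreover have "z \<in> ?C" using zB by (simp add: connected_component_refl_eq)
      then have "?C \<inter> open_region u \<noteq> {}" using z by blast
      ultimately have "?C \<inter> frontier (open_region u) \<noteq> {}"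
        by (intro connected_Int_frontier) auto
      with fr connected_component_subset[of "- B" z] show False by blast
    qed
    then have "bounded ?C"
      using open_region_subset[of u] bounded_subset[OF bounded_region[of u]] by blast
    with zB show "z \<in> inside B" by (simp add: inside_def)
  qed
  moreover have "inside B \<subseteq> region u"
  proof
    fix z assume z: "z \<in> inside B"
    show "z \<in> region u"
    proof (rule ccontr)
      assume nz: "z \<notin> region u"
      show False
      proof (cases "Re z < abscissa id (- Im z)")
        case True
        have "z + complex_of_real (- 1 * s) \<notin> B" if "0 \<le> s" for s
          using True that abscissa_id_le[OF u, of "- Im z"] by (simp add: B)
        from not_inside_of_ray[OF this] z show False by simp
      next
        case False
        have "z + complex_of_real (1 * s) \<notin> B" if "0 \<le> s" for s
          using False that nz abscissa_id_le[OF u, of "- Im z"] by (auto simp: B region_def)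
        from not_inside_of_ray[OF this] z show False by simp
      qed
    qed
  qed
  ultimately show ?thesis using BR RB unfolding elnitsky_polygon_def B_def[symmetric] by blast
qed

end

section \<open>Real functions: touching lines, gaps in finite sets, intervals of positivity\<close>

lemma affine_touch:
  fixes a d t :: real
  assumes "a < t" "t < d" "A + m * t = B + m' * t"
    "A + m * a \<le> B + m' * a" "A + m * d \<le> B + m' * d"
  shows "m = m'"
proof -
  have "0 \<le> (m' - m) * (a - t)" "0 \<le> (m' - m) * (d - t)"
    using assms by (simp_all add: algebra_simps)
  with assms(1,2) show ?thesis by (simp add: zero_le_mult_iff)
qed

lemma finite_gap_right:
  fixes x y :: real
  assumes "finite F" "x < y"
  obtains d where "x < d" "d \<le> y" "{x<..<d} \<inter> F = {}"
proof
  let ?d = "Min (insert y {f \<in> F. x < f})"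
  show "x < ?d" "?d \<le> y" using assms by auto
  show "{x<..<?d} \<inter> F = {}" using assms by (auto dest: Min_le_iff[THEN iffD2, rotated 2])
qed

lemma finite_gap_left:
  fixes x y :: real
  assumes "finite F" "x < y"
  obtains d where "x \<le> d" "d < y" "{d<..<y} \<inter> F = {}"
proof
  let ?d = "Max (insert x {f \<in> F. f < y})"
  show "x \<le> ?d" "?d < y" using assms by auto
  show "{?d<..<y} \<inter> F = {}" using assms by auto
qed

text \<open>\<open>b\<close> is the last zero before \<open>t\<close> and \<open>e\<close> the first
  one after it, both attained by compactness. Applied to the horizontal width of a region, this
  isolates a part where the two boundary paths are apart.\<close>

lemma positive_component:
  fixes g :: "real \<Rightarrow> real"
  assumes cont: "continuous_on {x..y} g" and t: "x < t" "t < y"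
    and g: "g x = 0" "g y = 0" "g t > 0" "\<And>s. g s \<ge> 0"
  obtains b e where "x \<le> b" "b < t" "t < e" "e \<le> y" "g b = 0" "g e = 0"
    "\<And>s. b < s \<Longrightarrow> s < e \<Longrightarrow> g s > 0"
proof -
  let ?B = "{s \<in> {x..t}. g s = 0}" and ?E = "{s \<in> {t..y}. g s = 0}"
  have "continuous_on {x..t} g" "continuous_on {t..y} g"
    using t by (auto intro: continuous_on_subset[OF cont])
  then have "closed ?B" "closed ?E"
    by (simp_all only: continuous_closed_preimage_constant closed_atLeastAtMost)
  then have "compact ({x..t} \<inter> ?B)" "compact ({t..y} \<inter> ?E)"
    by (auto intro!: compact_Int_closed)
  then have cpt: "compact ?B" "compact ?E" by (simp_all add: Int_absorb1 subset_iff)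
  have "?B \<noteq> {}" "?E \<noteq> {}" using t g by force+
  then obtain b e where b: "b \<in> ?B" "\<And>s. s \<in> ?B \<Longrightarrow> s \<le> b" and e: "e \<in> ?E" "\<And>s. s \<in> ?E \<Longrightarrow> e \<le> s"
    using compact_attains_sup[OF cpt(1)] compact_attains_inf[OF cpt(2)] by blast
  have pos: "g s > 0" if "b < s" "s < e" for s
  proof (rule ccontr)
    assume "\<not> g s > 0"
    with g(4)[of s] have "g s = 0" by simp
    then show False using b(1) e(1) b(2)[of s] e(2)[of s] that by (cases "s \<le> t") auto
  qed
  have "b \<noteq> t" "e \<noteq> t" using b e g by auto
  then show ?thesis using that[of b e] b e pos by auto
qed

context elnitsky
begin

section \<open>Peeling a tile off the right boundary\<close>

text \<open>
  Tilings without the edge-to-edge condition, of a region whose boundary paths may touch.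
\<close>

definition weak_tiling :: "(nat \<Rightarrow> nat) \<Rightarrow> complex set set \<Rightarrow> bool" where
  "weak_tiling u T \<longleftrightarrow> finite T \<and> (\<forall>R\<in>T. \<exists>L. is_tile n \<theta> R L) \<and>
     pairwise (\<lambda>R S. interior R \<inter> interior S = {}) T \<and> \<Union>T \<subseteq> region u \<and> open_region u \<subseteq> \<Union>T"

lemma is_tileE:
  assumes "is_tile n \<theta> R L"
  obtains p i j where "i \<in> {1..n}" "j \<in> {1..n}" "i < j" "L = {i, j}" "R = unit_rhombus p i j"
proof -
  from assms obtain p i j where ij: "i \<in> {1..n}" "j \<in> {1..n}" "i \<noteq> j" "L = {i, j}" "R = unit_rhombus p i j"
    unfolding is_tile_def by blast
  show ?thesis
  proof (cases "i < j")
    case True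
    with ij that show ?thesis by blast
  next
    case False
    with ij that[of j i p] show ?thesis by (simp add: insert_commute rhombus_commute)
  qed
qed

lemma tile_sides_in_region:
  assumes ij: "i \<in> {1..n}" "j \<in> {1..n}" "i < j" and sub: "unit_rhombus p i j \<subseteq> region u"
    and t: "- Im p \<le> t" "t \<le> - Im p + fall i + fall j"
  shows "right_side p i j t \<le> abscissa u t" "abscissa id t \<le> left_side p i j t"
    "0 \<le> t" "t \<le> depth id n"
proof -
  have "left_side p i j t \<le> right_side p i j t" using left_le_right_iff[OF ij] t by simp
  then have "Complex (right_side p i j t) (- t) \<in> region u" "Complex (left_side p i j t) (- t) \<in> region u"
    using sub mem_unit_rhombus[OF ij] by auto
  then show "right_side p i j t \<le> abscissa u t" "abscissa id t \<le> left_side p i j t"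
    "0 \<le> t" "t \<le> depth id n"
    by (simp_all add: region_def)
qed

text \<open>A tile inside the region cannot extend beyond the right path, so a point of that path
  can only lie on the right side of the tile.\<close>

lemma right_side_contact:
  assumes ij: "i \<in> {1..n}" "j \<in> {1..n}" "i < j" and sub: "unit_rhombus p i j \<subseteq> region u"
    and mem: "Complex (abscissa u t) (- t) \<in> unit_rhombus p i j"
  shows "right_side p i j t = abscissa u t" "- Im p \<le> t" "t \<le> - Im p + fall i + fall j"
proof -
  show t: "- Im p \<le> t" "t \<le> - Im p + fall i + fall j" using mem_unit_rhombus_depth[OF ij mem] by auto
  show "right_side p i j t = abscissa u t"
    using mem mem_unit_rhombus[OF ij] tile_sides_in_region(1)[OF ij sub t] by auto
qed

text \<open>On the interval both the path and the right side of the tile are affine, and the tile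
  stays to the left. Touching at an inner point forces equal slopes, hence equal labels, and then
  the two lines coincide.\<close>

lemma upper_contact:
  assumes u: "u permutes {1..n}" and k: "1 \<le> k" "k \<le> n"
    and ij: "i \<in> {1..n}" "j \<in> {1..n}" "i < j" and sub: "unit_rhombus p i j \<subseteq> region u"
    and t: "a < t" "t < d" and bounds: "depth u (k - 1) \<le> a" "d \<le> depth u k"
      "- Im p \<le> a" "d \<le> - Im p + fall j"
    and contact: "right_side p i j t = abscissa u t"
  shows "u k = j" "\<And>s. a \<le> s \<Longrightarrow> s \<le> d \<Longrightarrow> right_side p i j s = abscissa u s"
proof -
  define A where "A = Re p + slope j * Im p"
  define B where "B = Re (path_vertex \<theta> u (k - 1)) - slope (u k) * depth u (k - 1)"
  have fi: "0 < fall i" using fall_pos ij by simp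
  have f: "right_side p i j s = A + slope j * s" and g: "abscissa u s = B + slope (u k) * s"
    if "a \<le> s" "s \<le> d" for s
    using right_side_upper[OF ij, of s p] abscissa_piece[OF u k, of s] that bounds
    by (simp_all add: A_def B_def algebra_simps)
  have le: "right_side p i j s \<le> abscissa u s" if "a \<le> s" "s \<le> d" for s
    using tile_sides_in_region(1)[OF ij sub, of s] that bounds fi by simp
  have "slope j = slope (u k)"
    by (rule affine_touch[OF t, of A _ B]) (use le f g contact t in \<open>force+\<close>)
  then show "u k = j" using slope_inj[OF ij(2) permutes_in[OF u k]] by simp
  then have "A = B" using contact f[of t] g[of t] t by simp
  with \<open>u k = j\<close> show "right_side p i j s = abscissa u s" if "a \<le> s" "s \<le> d" for s
    using f g that by simp
qed

lemma lower_contact: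
  assumes u: "u permutes {1..n}" and k: "1 \<le> k" "k \<le> n"
    and ij: "i \<in> {1..n}" "j \<in> {1..n}" "i < j" and sub: "unit_rhombus p i j \<subseteq> region u"
    and t: "a < t" "t < d" and bounds: "depth u (k - 1) \<le> a" "d \<le> depth u k"
      "- Im p + fall j \<le> a" "d \<le> - Im p + fall i + fall j"
    and contact: "right_side p i j t = abscissa u t"
  shows "u k = i" "\<And>s. a \<le> s \<Longrightarrow> s \<le> d \<Longrightarrow> right_side p i j s = abscissa u s"
proof -
  define A where "A = Re p + slope i * Im p + fall j * (slope j - slope i)"
  define B where "B = Re (path_vertex \<theta> u (k - 1)) - slope (u k) * depth u (k - 1)"
  have fj: "0 < fall j" using fall_pos ij by simp
  have f: "right_side p i j s = A + slope i * s" and g: "abscissa u s = B + slope (u k) * s"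
    if "a \<le> s" "s \<le> d" for s
    using right_side_lower[OF ij, of p s] abscissa_piece[OF u k, of s] that bounds
    by (simp_all add: A_def B_def algebra_simps)
  have le: "right_side p i j s \<le> abscissa u s" if "a \<le> s" "s \<le> d" for s
    using tile_sides_in_region(1)[OF ij sub, of s] that bounds fj by simp
  have "slope i = slope (u k)"
    by (rule affine_touch[OF t, of A _ B]) (use le f g contact t in \<open>force+\<close>)
  then show "u k = i" using slope_inj[OF ij(1) permutes_in[OF u k]] by simp
  then have "A = B" using contact f[of t] g[of t] t by simp
  with \<open>u k = i\<close> show "right_side p i j s = abscissa u s" if "a \<le> s" "s \<le> d" for s
    using f g that by simp
qed

lemma corner_contact:
  assumes u: "u permutes {1..n}" and k: "1 \<le> k" "k < n"
    and ij: "i \<in> {1..n}" "j \<in> {1..n}" "i < j"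
    and contact: "right_side p i j (depth u k) = abscissa u (depth u k)"
    and corner: "- Im p + fall j = depth u k" and lab: "u k = j" "u (Suc k) = i"
  shows "unit_rhombus p i j = tile_at u k"
proof -
  have "Im p = Im (path_vertex \<theta> u (k - 1))"
    using corner Im_path_vertex[OF u, of "k - 1"] depth_pred[OF k(1), of u] k lab by simp
  moreover have "Re p + slope j * fall j = Re (path_vertex \<theta> u k)"
    using contact right_side_upper[OF ij, of "depth u k" p] corner abscissa_vertex[OF u, of k] k
    by (simp add: algebra_simps)
  then have "Re p = Re (path_vertex \<theta> u (k - 1))"
    using path_vertex_pred[OF k(1), of u] cis_angle[OF ij(2)] lab by simp
  ultimately have "p = path_vertex \<theta> u (k - 1)" by (intro complex_eqI)
  then show ?thesis by (simp add: tile_at_def lab)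
qed

text \<open>
  Just below the start of a component of the open region, the right boundary meets the upper right
  edges of tiles only, and just above its end it meets lower right edges only. At a
  change from upper to lower edges, the two tiles contain points to the left of the same boundary
  point, so they coincide and have their right corner there.
\<close>

lemma exists_tile_at_descent:
  assumes u: "u permutes {1..n}" and wt: "weak_tiling u T"
    and t0: "0 < t0" "t0 < depth id n" "abscissa id t0 < abscissa u t0"
  shows "\<exists>k. 1 \<le> k \<and> k < n \<and> u (Suc k) < u k \<and> tile_at u k \<in> T"
proof -
  have n: "n \<ge> 1" using t0 by (cases n) auto
  have top: "depth u n = depth id n" by (rule depth_top[OF u])
  have finT: "finite T" and subT: "\<And>R. R \<in> T \<Longrightarrow> R \<subseteq> region u" and cover: "open_region u \<subseteq> \<Union>T"
    and disj: "pairwise (\<lambda>R S. interior R \<inter> interior S = {}) T"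
    using wt by (auto simp: weak_tiling_def)
  have "\<forall>R\<in>T. \<exists>x. fst (snd x) \<in> {1..n} \<and> snd (snd x) \<in> {1..n} \<and> fst (snd x) < snd (snd x) \<and>
      R = unit_rhombus (fst x) (fst (snd x)) (snd (snd x))"
  proof
    fix R assume "R \<in> T"
    then obtain L where "is_tile n \<theta> R L" using wt by (auto simp: weak_tiling_def)
    then show "\<exists>x. fst (snd x) \<in> {1..n} \<and> snd (snd x) \<in> {1..n} \<and> fst (snd x) < snd (snd x) \<and>
      R = unit_rhombus (fst x) (fst (snd x)) (snd (snd x))"
      by (rule is_tileE) (metis fst_conv snd_conv)
  qed
  from bchoice[OF this] obtain x where x: "\<forall>R\<in>T. fst (snd (x R)) \<in> {1..n} \<and> snd (snd (x R)) \<in> {1..n} \<and>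
      fst (snd (x R)) < snd (snd (x R)) \<and>
      R = unit_rhombus (fst (x R)) (fst (snd (x R))) (snd (snd (x R)))" ..
  define P I J where "P R = fst (x R)" and "I R = fst (snd (x R))" and "J R = snd (snd (x R))" for R
  have ij: "I R \<in> {1..n}" "J R \<in> {1..n}" "I R < J R" and R: "unit_rhombus (P R) (I R) (J R) = R"
    if "R \<in> T" for R
    using x that by (simp_all add: P_def I_def J_def)
  have sub: "unit_rhombus (P R) (I R) (J R) \<subseteq> region u" if "R \<in> T" for R
    using subT[OF that] R[OF that] by simp
  define upper corner lower where "upper R = - Im (P R)" and "corner R = - Im (P R) + fall (J R)"
    and "lower R = - Im (P R) + fall (I R) + fall (J R)" for R
  have order: "upper R < corner R" "corner R < lower R" if "R \<in> T" for R
    using fall_pos[OF ij(1)[OF that]] fall_pos[OF ij(2)[OF that]]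
    by (simp_all add: upper_def corner_def lower_def)
  \<comment> \<open>\<open>F\<close> collects the breakpoints: in a gap of \<open>F\<close> the
    right path and the right sides of all tiles are affine, so a contact at one inner depth extends
    over the whole gap.\<close>
  define F where "F = depth u ` {..n} \<union> upper ` T \<union> corner ` T \<union> lower ` T"
  have finF: "finite F" using finT by (simp add: F_def)
  define contact where "contact R t \<longleftrightarrow> right_side (P R) (I R) (J R) t = abscissa u t" for R t
  define A where "A t \<longleftrightarrow> (\<exists>R\<in>T. contact R t \<and> upper R < t \<and> t < corner R)" for t
  define B where "B t \<longleftrightarrow> (\<exists>R\<in>T. contact R t \<and> corner R < t \<and> t < lower R)" for t
  have "continuous_on {0..depth id n} (\<lambda>t. abscissa u t - abscissa id t)"
    by (intro continuous_intros continuous_weigh)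
  from positive_component[OF this t0(1,2)] obtain b e where be: "0 \<le> b" "b < t0" "t0 < e" "e \<le> depth id n"
    "abscissa u b = abscissa id b" "abscissa u e = abscissa id e"
    and pos: "\<And>s. b < s \<Longrightarrow> s < e \<Longrightarrow> abscissa id s < abscissa u s"
    using abscissa_ends[OF u] t0(3) abscissa_id_le[OF u] by auto
  have piece: "\<exists>k. 1 \<le> k \<and> k \<le> n \<and> depth u (k - 1) \<le> y \<and> z \<le> depth u k"
    if gap: "y < t" "t < z" "{y<..<z} \<inter> F = {}" "b \<le> y" "z \<le> e" for y t z
  proof -
    obtain k where k: "1 \<le> k" "k \<le> n" "depth u (k - 1) \<le> t" "t \<le> depth u k"
      using exists_piece[OF u n, of t] gap be top by auto
    have "depth u (k - 1) \<in> F" "depth u k \<in> F" using k by (auto simp: F_def)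
    then have "depth u (k - 1) \<notin> {y<..<z}" "depth u k \<notin> {y<..<z}" using gap by blast+
    then show ?thesis using k gap by (intro exI[of _ k]) auto
  qed
  have gapA: "\<exists>R\<in>T. (\<forall>s. y \<le> s \<and> s \<le> z \<longrightarrow> contact R s) \<and> upper R \<le> y \<and> z \<le> corner R \<and>
      (\<exists>k. 1 \<le> k \<and> k \<le> n \<and> depth u (k - 1) \<le> y \<and> z \<le> depth u k \<and> u k = J R)"
    if "A t" and gap: "y < t" "t < z" "{y<..<z} \<inter> F = {}" "b \<le> y" "z \<le> e" for y t z
  proof -
    obtain R where RT: "R \<in> T" and c: "contact R t" "upper R < t" "t < corner R"
      using \<open>A t\<close> by (auto simp: A_def)
    obtain k where k: "1 \<le> k" "k \<le> n" "depth u (k - 1) \<le> y" "z \<le> depth u k"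
      using piece[OF gap] by blast
    have "upper R \<in> F" "corner R \<in> F" using RT by (auto simp: F_def)
    then have "upper R \<notin> {y<..<z}" "corner R \<notin> {y<..<z}" using gap(3) by blast+
    then have bd: "upper R \<le> y" "z \<le> corner R" using c gap by auto
    have "u k = J R" "\<And>s. y \<le> s \<Longrightarrow> s \<le> z \<Longrightarrow> contact R s"
      unfolding contact_def
      using upper_contact[OF u k(1,2) ij[OF RT] sub[OF RT] gap(1,2) k(3,4)] bd c
      by (auto simp: upper_def corner_def contact_def)
    with RT bd k show ?thesis by blast
  qed
  have gapB: "\<exists>R\<in>T. (\<forall>s. y \<le> s \<and> s \<le> z \<longrightarrow> contact R s) \<and> corner R \<le> y \<and> z \<le> lower R \<and>
      (\<exists>k. 1 \<le> k \<and> k \<le> n \<and> depth u (k - 1) \<le> y \<and> z \<le> depth u k \<and> u k = I R)"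
    if "B t" and gap: "y < t" "t < z" "{y<..<z} \<inter> F = {}" "b \<le> y" "z \<le> e" for y t z
  proof -
    obtain R where RT: "R \<in> T" and c: "contact R t" "corner R < t" "t < lower R"
      using \<open>B t\<close> by (auto simp: B_def)
    obtain k where k: "1 \<le> k" "k \<le> n" "depth u (k - 1) \<le> y" "z \<le> depth u k"
      using piece[OF gap] by blast
    have "corner R \<in> F" "lower R \<in> F" using RT by (auto simp: F_def)
    then have "corner R \<notin> {y<..<z}" "lower R \<notin> {y<..<z}" using gap(3) by blast+
    then have bd: "corner R \<le> y" "z \<le> lower R" using c gap by auto
    have "u k = I R" "\<And>s. y \<le> s \<Longrightarrow> s \<le> z \<Longrightarrow> contact R s"
      unfolding contact_def
      using lower_contact[OF u k(1,2) ij[OF RT] sub[OF RT] gap(1,2) k(3,4)] bd c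
      by (auto simp: corner_def lower_def contact_def)
    with RT bd k show ?thesis by blast
  qed
  have AB: "A t \<or> B t" if t: "b < t" "t < e" "t \<notin> F" for t
  proof -
    \<comment> \<open>Points slightly further left belong to the open region and are covered, and
      the union of finitely many closed tiles is closed.\<close>
    have "Complex (abscissa u t) (- t) \<in> \<Union>T"
    proof (rule ccontr)
      assume nm: "Complex (abscissa u t) (- t) \<notin> \<Union>T"
      have "closed (\<Union>T)"
        using finT R closed_rhombus by (metis closed_Union)
      then obtain r where r: "r > 0" "ball (Complex (abscissa u t) (- t)) r \<subseteq> - \<Union>T"
        using nm by (metis ComplI open_Compl open_contains_ball)
      obtain y where y: "max (abscissa id t) (abscissa u t - r) < y" "y < abscissa u t"
        using dense[of "max (abscissa id t) (abscissa u t - r)" "abscissa u t"] pos t r by auto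
      have "dist (Complex (abscissa u t) (- t)) (Complex y (- t)) = \<bar>abscissa u t - y\<bar>"
        by (simp add: dist_complex_def complex_diff cmod_def)
      then have "Complex y (- t) \<in> ball (Complex (abscissa u t) (- t)) r" using y by simp
      moreover have "Complex y (- t) \<in> open_region u" using y t be by (simp add: open_region_def)
      ultimately show False using r cover by blast
    qed
    then obtain R' where RT: "R' \<in> T" and mem: "Complex (abscissa u t) (- t) \<in> R'" by blast
    from mem have "Complex (abscissa u t) (- t) \<in> unit_rhombus (P R') (I R') (J R')" using R[OF RT] by simp
    note c = right_side_contact[OF ij[OF RT] sub[OF RT] this]
    have "upper R' \<noteq> t" "corner R' \<noteq> t" "lower R' \<noteq> t" using t(3) RT by (auto simp: F_def)
    then show ?thesis
      using c RT unfolding A_def B_def contact_def upper_def corner_def lower_def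
      by (metis linorder_neqE_linordered_idom order_le_less)
  qed
  define S where "S = {t. b < t \<and> t < e \<and> t \<notin> F \<and> A t}"
  obtain d where d: "b < d" "d \<le> e" "{b<..<d} \<inter> F = {}" using finite_gap_right[OF finF, of b e] be by auto
  have "S \<noteq> {}"
  proof -
    define t where "t = (b + d) / 2"
    have t: "b < t" "t < d" using d by (simp_all add: t_def)
    \<comment> \<open>A tile meeting the path with its lower right edge just below \<open>b\<close>
      begins above \<open>b\<close>, so it has positive width at depth \<open>b\<close>, where the
      region is a single point.\<close>
    have "\<not> B t"
    proof
      assume "B t"
      from gapB[OF this t d(3)] d obtain R where RT: "R \<in> T" and c: "contact R b" "corner R \<le> b" "d \<le> lower R"
        by force
      have "upper R < b" "b < lower R" using order[OF RT] c d by auto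
      then show False
        using left_less_right[OF ij[OF RT], of "P R" b] tile_sides_in_region(2)[OF ij[OF RT] sub[OF RT], of b]
          c(1) be(5) by (simp add: upper_def lower_def contact_def)
    qed
    moreover have "t \<notin> F" using t d(3) by auto
    ultimately have "t \<in> S" using AB[of t] t d by (auto simp: S_def)
    then show ?thesis by blast
  qed
  have bdd: "bdd_above S" by (rule bdd_aboveI[of _ e]) (auto simp: S_def)
  define y where "y = Sup S"
  obtain d' where d': "b \<le> d'" "d' < e" "{d'<..<e} \<inter> F = {}" using finite_gap_left[OF finF, of b e] be by auto
  \<comment> \<open>The mirror image at \<open>e\<close>: a tile met by its upper right edge would
    continue below \<open>e\<close> and have positive width at that depth. This keeps the supremum
    \<open>y\<close> away from \<open>e\<close>.\<close>
  have "t \<le> d'" if "t \<in> S" for t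
  proof (rule ccontr)
    assume "\<not> t \<le> d'"
    with that have t: "d' < t" "t < e" "A t" by (auto simp: S_def)
    from gapA[OF t(3,1,2) d'(3,1)] obtain R where RT: "R \<in> T" and c: "contact R e" "upper R \<le> d'" "e \<le> corner R"
      using d' by force
    have "upper R < e" "e < lower R" using order[OF RT] c d' by auto
    then show False
      using left_less_right[OF ij[OF RT], of "P R" e] tile_sides_in_region(2)[OF ij[OF RT] sub[OF RT], of e]
        c(1) be(6) by (simp add: upper_def lower_def contact_def)
  qed
  then have "y \<le> d'" unfolding y_def using \<open>S \<noteq> {}\<close> by (intro cSup_least)
  then have ye: "y < e" using d' by simp
  obtain s where "s \<in> S" using \<open>S \<noteq> {}\<close> by blast
  then have "b < s" "s \<le> y" using bdd by (auto simp: S_def y_def intro: cSup_upper)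
  then have yb: "b < y" by simp
  obtain x1 where x1: "b \<le> x1" "x1 < y" "{x1<..<y} \<inter> F = {}" using finite_gap_left[OF finF yb] by auto
  obtain x2 where x2: "y < x2" "x2 \<le> e" "{y<..<x2} \<inter> F = {}" using finite_gap_right[OF finF ye] by auto
  define t2 where "t2 = (y + x2) / 2"
  have t2: "y < t2" "t2 < x2" using x2 by (simp_all add: t2_def)
  have t2F: "t2 \<notin> F" using t2 x2 by auto
  have "t2 \<notin> S" using t2 bdd by (auto simp: y_def dest: cSup_upper)
  then have "\<not> A t2" using t2 t2F yb x2 by (auto simp: S_def)
  then have "B t2" using AB[of t2] t2 t2F yb x2 by auto
  \<comment> \<open>Otherwise \<open>y\<close> would not be a breakpoint, and the contact with the
    upper edge would persist to \<open>t2\<close>, beyond the supremum.\<close>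
  have "y \<notin> S"
  proof
    assume "y \<in> S"
    then have "A y" "y \<notin> F" by (auto simp: S_def)
    have gap: "{x1<..<x2} \<inter> F = {}"
    proof -
      have "{x1<..<x2} = {x1<..<y} \<union> {y} \<union> {y<..<x2}" using x1 x2 by auto
      then show ?thesis using x1 x2 \<open>y \<notin> F\<close> by auto
    qed
    from gapA[OF \<open>A y\<close> x1(2) x2(1) gap x1(1) x2(2)] obtain R where "R \<in> T"
      and c: "\<forall>s. x1 \<le> s \<and> s \<le> x2 \<longrightarrow> contact R s" and bd: "upper R \<le> x1" "x2 \<le> corner R" by blast
    have "contact R t2" using c t2 x1 by simp
    moreover have "upper R < t2" "t2 < corner R" using bd t2 x1 by auto
    ultimately have "A t2" using \<open>R \<in> T\<close> by (auto simp: A_def)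
    with \<open>\<not> A t2\<close> show False ..
  qed
  obtain t1 where "t1 \<in> S" "x1 < t1" using less_cSup_iff[OF \<open>S \<noteq> {}\<close> bdd, of x1] x1 by (auto simp: y_def)
  moreover have "t1 \<le> y" using \<open>t1 \<in> S\<close> bdd by (auto simp: y_def intro: cSup_upper)
  ultimately have t1: "x1 < t1" "t1 < y" "A t1" using \<open>y \<notin> S\<close> by (auto simp: S_def order_le_less)
  from gapA[OF t1(3,1,2) x1(3,1)] ye obtain R1 k1 where R1: "R1 \<in> T" "contact R1 y" "upper R1 \<le> x1" "y \<le> corner R1"
    and k1: "1 \<le> k1" "k1 \<le> n" "depth u (k1 - 1) \<le> x1" "y \<le> depth u k1" "u k1 = J R1"
    using x1 by force
  from gapB[OF \<open>B t2\<close> t2 x2(3) _ x2(2)] yb obtain R2 k2 where R2: "R2 \<in> T" "contact R2 y" "corner R2 \<le> y" "x2 \<le> lower R2"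
    and k2: "1 \<le> k2" "k2 \<le> n" "depth u (k2 - 1) \<le> y" "x2 \<le> depth u k2" "u k2 = I R2"
    using x2 by force
  have "interior (unit_rhombus (P R1) (I R1) (J R1)) \<inter> interior (unit_rhombus (P R2) (I R2) (J R2)) \<noteq> {}"
  proof (rule overlap_at_right_side[OF ij[OF R1(1)] ij[OF R2(1)]])
    show "- Im (P R1) < y" "y < - Im (P R1) + fall (I R1) + fall (J R1)"
      using R1 x1 order[OF R1(1)] by (auto simp: upper_def lower_def)
    show "- Im (P R2) < y" "y < - Im (P R2) + fall (I R2) + fall (J R2)"
      using R2 x2 order[OF R2(1)] by (auto simp: upper_def lower_def)
    show "right_side (P R1) (I R1) (J R1) y = right_side (P R2) (I R2) (J R2) y"
      using R1 R2 by (simp add: contact_def)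
  qed
  then have "interior R1 \<inter> interior R2 \<noteq> {}" unfolding R[OF R1(1)] R[OF R2(1)] .
  then have "R1 = R2" using pairwiseD[OF disj R1(1) R2(1)] by blast
  then have cy: "corner R1 = y" using R1 R2 by simp
  \<comment> \<open>The path arrives at \<open>y\<close> along the larger label of the common tile
    and leaves along the smaller one; monotonicity of the depths makes these two edges
    consecutive.\<close>
  have "k1 \<noteq> k2" using k1 k2 ij(3)[OF R1(1)] \<open>R1 = R2\<close> by auto
  have "depth u (k1 - 1) < depth u k2" using k1 k2 x1 x2 by simp
  then have "k1 - 1 < k2" using depth_le[OF u, of k2 "k1 - 1"] k1(2) by force
  then have "k1 \<le> k2 - 1" using \<open>k1 \<noteq> k2\<close> by simp
  moreover have "k2 - 1 \<le> k1" using depth_le_iff[OF u, of "k2 - 1" k1] k1 k2 by simp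
  ultimately have kk: "k2 = Suc k1" using k2 by simp
  then have yk: "y = depth u k1" using k1 k2 by simp
  have "k1 < n" using kk k2 by simp
  have "unit_rhombus (P R1) (I R1) (J R1) = tile_at u k1"
    using corner_contact[OF u k1(1) \<open>k1 < n\<close> ij[OF R1(1)]] R1(2) cy yk k1(5) k2(5) kk \<open>R1 = R2\<close>
    by (simp add: contact_def corner_def)
  then show ?thesis
    using R[OF R1(1)] R1(1) ij(3)[OF R1(1)] k1 k2 kk \<open>k1 < n\<close> \<open>R1 = R2\<close> by (intro exI[of _ k1]) auto
qed

section \<open>Removing the tile at a descent, and recognising tiles along the right path\<close>

lemma mem_tile_at_iff:
  assumes "u permutes {1..n}" "1 \<le> k" "k < n" "u (Suc k) < u k"
  shows "z \<in> tile_at u k \<longleftrightarrow> depth u (k - 1) \<le> - Im z \<and> - Im z \<le> depth u (Suc k) \<and>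
    abscissa (swap_at u k) (- Im z) \<le> Re z \<and> Re z \<le> abscissa u (- Im z)"
  using mem_tile_at[OF assms, of "Re z" "- Im z"] by simp

lemma tile_at_labels:
  assumes "u permutes {1..n}" "1 \<le> k" "k < n"
  shows "u (Suc k) \<in> {1..n}" "u k \<in> {1..n}"
  using permutes_in[OF assms(1)] assms by auto

text \<open>The two strict inequalities confine the depth to that of the tile, because elsewhere the
  paths before and after the exchange coincide.\<close>

lemma interior_tile_at:
  assumes u: "u permutes {1..n}" and k: "1 \<le> k" "k < n" "u (Suc k) < u k"
    and z: "abscissa (swap_at u k) (- Im z) < Re z" "Re z < abscissa u (- Im z)"
  shows "z \<in> interior (tile_at u k)"
proof -
  have t: "depth u (k - 1) \<le> - Im z" "- Im z \<le> depth u (Suc k)"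
    using z abscissa_swap_at_outside[OF u k(1,2), of "- Im z"] by force+
  show ?thesis unfolding tile_at_def
    by (rule interior_unit_rhombus[OF tile_at_labels[OF u k(1,2)] k(3)])
      (simp_all only: left_side_tile_at[OF u k t] right_side_tile_at[OF u k t] z)
qed

lemma tile_at_subset_region:
  assumes u: "u permutes {1..n}" and k: "1 \<le> k" "k < n" "u (Suc k) < u k"
  shows "tile_at u k \<subseteq> region u"
proof
  fix z assume z: "z \<in> tile_at u k"
  have "0 \<le> depth u (k - 1)" "depth u (Suc k) \<le> depth id n"
    using depth_le[OF u, of 0 "k - 1"] depth_le[OF u, of "Suc k" n] k depth_top[OF u] by auto
  moreover have "abscissa id (- Im z) \<le> abscissa (swap_at u k) (- Im z)"
    by (rule abscissa_id_le[OF swap_at_permutes[OF u k(1,2)]])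
  ultimately show "z \<in> region u" using z unfolding mem_tile_at_iff[OF assms] region_def by auto
qed

lemma region_swap_at:
  assumes u: "u permutes {1..n}" and k: "1 \<le> k" "k < n" "u (Suc k) < u k"
  shows "region u = region (swap_at u k) \<union> tile_at u k"
proof (intro equalityI subsetI)
  fix z assume z: "z \<in> region u"
  show "z \<in> region (swap_at u k) \<union> tile_at u k"
  proof (cases "Re z \<le> abscissa (swap_at u k) (- Im z)")
    case True
    then show ?thesis using z by (simp add: region_def)
  next
    case False
    then have "depth u (k - 1) \<le> - Im z" "- Im z \<le> depth u (Suc k)"
      using z abscissa_swap_at_outside[OF u k(1,2), of "- Im z"] by (force simp: region_def)+
    then show ?thesis using z False by (simp add: mem_tile_at_iff[OF assms] region_def)
  qed
next
  fix z assume "z \<in> region (swap_at u k) \<union> tile_at u k"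
  then show "z \<in> region u"
    using tile_at_subset_region[OF assms] abscissa_swap_at_le[OF assms, of "- Im z"]
    by (auto simp: region_def)
qed

lemma interior_unit_rhombus_nonempty:
  assumes ij: "i \<in> {1..n}" "j \<in> {1..n}" "i < j"
  shows "interior (unit_rhombus p i j) \<noteq> {}"
proof -
  have "0 < fall i" "0 < fall j" using ij fall_pos by auto
  then show ?thesis
    \<comment> \<open>The tile is compared with itself at the depth of its right corner.\<close>
    using overlap_at_right_side[OF ij ij, of p "- Im p + fall j" p] by auto
qed

text \<open>The point is that no remaining tile reaches beyond the new right path. If one did, then
  some interior point of it would as well, and such a point would be interior to the removed
  tile.\<close>

lemma weak_tiling_remove:
  assumes u: "u permutes {1..n}" and k: "1 \<le> k" "k < n" "u (Suc k) < u k"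
    and wt: "weak_tiling u T" and mem: "tile_at u k \<in> T"
  shows "weak_tiling (swap_at u k) (T - {tile_at u k})"
proof -
  have "open_region (swap_at u k) \<subseteq> \<Union>(T - {tile_at u k})"
  proof
    fix z assume z: "z \<in> open_region (swap_at u k)"
    then have "z \<in> open_region u"
      using abscissa_swap_at_le[OF u k, of "- Im z"] by (simp add: open_region_def)
    moreover have "z \<notin> tile_at u k" using z by (simp add: open_region_def mem_tile_at_iff[OF u k])
    ultimately show "z \<in> \<Union>(T - {tile_at u k})" using wt by (auto simp: weak_tiling_def)
  qed
  moreover have "S \<subseteq> region (swap_at u k)" if S: "S \<in> T" "S \<noteq> tile_at u k" for S
  proof
    fix z assume z: "z \<in> S"
    have Su: "S \<subseteq> region u" using wt S by (auto simp: weak_tiling_def)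
    show "z \<in> region (swap_at u k)"
    proof (rule ccontr)
      assume "z \<notin> region (swap_at u k)"
      let ?U = "{z. abscissa (swap_at u k) (- Im z) < Re z}"
      have "z \<in> ?U" using z Su \<open>z \<notin> region (swap_at u k)\<close> by (auto simp: region_def)
      have "open ?U" by (intro open_Collect_less continuous_abscissa_Im continuous_intros)
      obtain L where "is_tile n \<theta> S L" using wt S(1) unfolding weak_tiling_def by blast
      then obtain p i j where ij: "i \<in> {1..n}" "j \<in> {1..n}" "i < j" and Sij: "S = unit_rhombus p i j"
        by (rule is_tileE)
      \<comment> \<open>A convex set with nonempty interior is contained in the closure of its
        interior, so \<open>z\<close> can be replaced by an interior point of \<open>S\<close> that
        is still in the open set \<open>?U\<close>.\<close>
      have "closure (interior S) = closure S"
        unfolding Sij by (rule convex_closure_interior[OF convex_rhombus interior_unit_rhombus_nonempty[OF ij]])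
      then have "z \<in> closure (interior S)" using z closure_subset by blast
      then obtain z' where z': "z' \<in> ?U" "z' \<in> interior S"
        using \<open>z \<in> ?U\<close> \<open>open ?U\<close> open_Int_closure_eq_empty[of ?U "interior S"] by blast
      obtain r where r: "r > 0" "cball z' r \<subseteq> S"
        using z'(2) by (metis mem_interior_cball)
      \<comment> \<open>A whole ball around \<open>z'\<close> lies in the region; its rightmost
        point shows that \<open>z'\<close> is strictly left of the right path.\<close>
      have "z' + complex_of_real r \<in> cball z' r" using r by (simp add: dist_norm)
      then have "z' + complex_of_real r \<in> region u" using r Su by blast
      then have "Re z' < abscissa u (- Im z')" using r by (simp add: region_def)
      then have "z' \<in> interior (tile_at u k)" using z' by (intro interior_tile_at[OF u k]) auto
      then show False using z' S mem wt by (auto simp: weak_tiling_def pairwise_def)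
    qed
  qed
  ultimately show ?thesis
    using wt unfolding weak_tiling_def
    by (auto intro: pairwise_subset)
qed

text \<open>
  The tile at a descent formed by a left-to-right maximum and a right-to-left minimum survives
  the removal of tiles at other descents, so it is removed itself at some stage.
\<close>

lemma tile_at_in_weak_tiling:
  assumes "w permutes {1..n}" and k: "1 \<le> k" "k < n" "w (Suc k) < w k"
    and "\<And>i. 1 \<le> i \<Longrightarrow> i < k \<Longrightarrow> w i < w k"
    and "\<And>i. Suc k < i \<Longrightarrow> i \<le> n \<Longrightarrow> w (Suc k) < w i"
    and "weak_tiling w T"
  shows "tile_at w k \<in> T"
  using assms
proof (induction "card T" arbitrary: w T rule: less_induct)
  case less
  note w = less.prems(1) and k = less.prems(2-4) and left = less.prems(5) and right = less.prems(6)
    and wt = less.prems(7)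
  have dk: "depth w (k - 1) < depth w k" "depth w k < depth w (Suc k)"
    using k by (auto intro!: depth_less[OF w])
  \<comment> \<open>At the depth of the corner of the wanted tile the region has positive width, so
    there is always a tile to peel off.\<close>
  have "abscissa id (depth w k) \<le> abscissa (swap_at w k) (depth w k)"
    by (rule abscissa_id_le[OF swap_at_permutes[OF w k(1,2)]])
  also have "\<dots> < abscissa w (depth w k)" by (rule abscissa_swap_at_less[OF w k dk])
  finally have "abscissa id (depth w k) < abscissa w (depth w k)" .
  moreover have "0 < depth w k" "depth w k < depth id n"
    using depth_less[OF w, of 0 k] depth_less[OF w, of k n] k depth_top[OF w] by auto
  ultimately obtain l where l: "1 \<le> l" "l < n" "w (Suc l) < w l" "tile_at w l \<in> T"
    using exists_tile_at_descent[OF w wt] by blast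
  show ?case
  proof (cases "l = k")
    case False
    \<comment> \<open>A descent at \<open>Suc k\<close> would put a smaller entry to the right of
      the minimum \<open>w (Suc k)\<close>; one ending at \<open>k\<close> would put a larger entry
      to the left of the maximum \<open>w k\<close>.\<close>
    have "l \<noteq> Suc k" using right[of "Suc (Suc k)"] l by auto
    moreover have "Suc l \<noteq> k" using left[of l] l by auto
    ultimately have far: "k \<noteq> l" "k \<noteq> Suc l" "Suc k \<noteq> l" "Suc k \<noteq> Suc l" using False by auto
    let ?v = "swap_at w l"
    have vk: "?v k = w k" "?v (Suc k) = w (Suc k)" using far by simp_all
    have "k - 1 \<noteq> l" using far k by auto
    then have same: "tile_at ?v k = tile_at w k"
      unfolding tile_at_def vk using l path_vertex_swap_at by simp
    have "finite T" using wt by (simp add: weak_tiling_def)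
    then have "card (T - {tile_at w l}) < card T" using l by (intro card_Diff1_less)
    moreover have "?v i < ?v k" if i: "1 \<le> i" "i < k" for i
    proof -
      have "Transposition.transpose l (Suc l) i < k" "1 \<le> Transposition.transpose l (Suc l) i"
        using i far l k by (auto simp: Transposition.transpose_def)
      then show ?thesis unfolding vk using left by (simp add: swap_at_def)
    qed
    moreover have "?v (Suc k) < ?v i" if i: "Suc k < i" "i \<le> n" for i
    proof -
      have "Suc k < Transposition.transpose l (Suc l) i" "Transposition.transpose l (Suc l) i \<le> n"
        using i far l k by (auto simp: Transposition.transpose_def)
      then show ?thesis unfolding vk using right by (simp add: swap_at_def)
    qed
    ultimately have "tile_at ?v k \<in> T - {tile_at w l}"
      using less.hyps[of "T - {tile_at w l}" ?v] swap_at_permutes[OF w l(1,2)] k vk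
        weak_tiling_remove[OF w l(1-3) wt l(4)] by simp
    then show ?thesis by (simp add: same)
  qed (use l in simp)
qed

text \<open>If the right corner of the tile were not at the vertex between the two edges, then one
  straight edge of the tile would run along parts of both of them, and the two edges would carry the
  same label.\<close>

lemma tile_of_consecutive_edges:
  assumes w: "w permutes {1..n}" and k: "1 \<le> k" "k < n"
    and ij: "i \<in> {1..n}" "j \<in> {1..n}" "i < j" and sub: "unit_rhombus p i j \<subseteq> region w"
    and edges: "path_edge \<theta> w k \<subseteq> unit_rhombus p i j" "path_edge \<theta> w (Suc k) \<subseteq> unit_rhombus p i j"
  shows "unit_rhombus p i j = tile_at w k" "w k = j" "w (Suc k) = i"
proof -
  have mem: "Complex (abscissa w t) (- t) \<in> unit_rhombus p i j"
    if "depth w (k - 1) \<le> t" "t \<le> depth w (Suc k)" for t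
    using that edges k path_edge_mem[OF w, of k t] path_edge_mem[OF w, of "Suc k" t]
    by (cases "t \<le> depth w k") auto
  note contact = right_side_contact[OF ij sub mem]
  have dk: "depth w (k - 1) < depth w k" "depth w k < depth w (Suc k)"
    using k by (auto intro!: depth_less[OF w])
  have bd: "- Im p \<le> depth w (k - 1)" "depth w (Suc k) \<le> - Im p + fall i + fall j"
    using contact(2)[of "depth w (k - 1)"] contact(3)[of "depth w (Suc k)"] dk by auto
  have ne: "w k \<noteq> w (Suc k)" using permutes_inj[OF w] by (simp add: inj_eq)
  have k': "1 \<le> Suc k" "Suc k \<le> n" "k \<le> n" using k by auto
  have corner: "- Im p + fall j = depth w k"
  proof (rule ccontr)
    assume "- Im p + fall j \<noteq> depth w k"
    then consider "depth w k < - Im p + fall j" | "- Im p + fall j < depth w k" by linarith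
    then show False
    proof cases
      case 1
      obtain s where s: "depth w (k - 1) < s" "s < depth w k" using dense[OF dk(1)] by blast
      have "w k = j"
        by (rule upper_contact(1)[OF w k(1) k'(3) ij sub s]) (use 1 bd s dk contact(1)[of s] in auto)
      \<comment> \<open>The minimum keeps the interval inside boundary edge \<open>Suc k\<close> and
        above the corner of the tile at the same time; the maximum \<open>a\<close> below plays the
        mirrored role.\<close>
      define d where "d = min (- Im p + fall j) (depth w (Suc k))"
      have "depth w k < d" using 1 dk by (simp add: d_def)
      then obtain s where s: "depth w k < s" "s < d" using dense by blast
      have "w (Suc k) = j"
        by (rule upper_contact(1)[OF w k'(1,2) ij sub s])
          (use 1 bd s dk contact(1)[of s] in \<open>auto simp: d_def\<close>)
      with \<open>w k = j\<close> ne show False by simp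
    next
      case 2
      define a where "a = max (- Im p + fall j) (depth w (k - 1))"
      have "a < depth w k" using 2 dk by (simp add: a_def)
      then obtain s where s: "a < s" "s < depth w k" using dense by blast
      have "w k = i"
        by (rule lower_contact(1)[OF w k(1) k'(3) ij sub s])
          (use 2 bd s dk contact(1)[of s] in \<open>auto simp: a_def\<close>)
      obtain s where s: "depth w k < s" "s < depth w (Suc k)" using dense[OF dk(2)] by blast
      have "w (Suc k) = i"
        by (rule lower_contact(1)[OF w k'(1,2) ij sub s]) (use 2 bd s dk contact(1)[of s] in auto)
      with \<open>w k = i\<close> ne show False by simp
    qed
  qed
  obtain s where s: "depth w (k - 1) < s" "s < depth w k" using dense[OF dk(1)] by blast
  show wk: "w k = j"
    by (rule upper_contact(1)[OF w k(1) k'(3) ij sub s]) (use corner bd s dk contact(1)[of s] in auto)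
  obtain s where s: "depth w k < s" "s < depth w (Suc k)" using dense[OF dk(2)] by blast
  show wSk: "w (Suc k) = i"
    by (rule lower_contact(1)[OF w k'(1,2) ij sub s]) (use corner bd s dk contact(1)[of s] in auto)
  show "unit_rhombus p i j = tile_at w k"
    by (rule corner_contact[OF w k ij _ corner wk wSk]) (use contact(1) dk in auto)
qed

text \<open>Both tiles contain the points immediately to the left of a common point of their right
  sides, so they coincide and so do the depths of their top vertices. Two permutations are involved
  because a tile on the boundary of \<open>w\<close> is to be compared with one at an intermediate
  stage.\<close>

lemma overlapping_tiles_at:
  assumes u: "u permutes {1..n}" and k: "1 \<le> k" "k < n" "u (Suc k) < u k"
    and v: "v permutes {1..n}" and l: "1 \<le> l" "l < n" "v (Suc l) < v l"
    and t: "depth u (k - 1) < t" "t < depth u (Suc k)" "depth v (l - 1) < t" "t < depth v (Suc l)"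
    and eq: "abscissa u t = abscissa v t"
    and T: "pairwise (\<lambda>R S. interior R \<inter> interior S = {}) T" "tile_at u k \<in> T" "tile_at v l \<in> T"
  shows "depth u (k - 1) = depth v (l - 1)"
proof -
  have ends: "- Im (path_vertex \<theta> x (i - 1)) = depth x (i - 1)"
    "- Im (path_vertex \<theta> x (i - 1)) + fall (x (Suc i)) + fall (x i) = depth x (Suc i)"
    if "x permutes {1..n}" "1 \<le> i" "i < n" for x i
    using Im_path_vertex[OF that(1), of "i - 1"] that depth_pred[of i x] by (simp_all add: depth_Suc)
  have "interior (tile_at u k) \<inter> interior (tile_at v l) \<noteq> {}"
    unfolding tile_at_def
  proof (rule overlap_at_right_side[OF tile_at_labels[OF u k(1,2)] k(3) tile_at_labels[OF v l(1,2)] l(3)])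
    show "right_side (path_vertex \<theta> u (k - 1)) (u (Suc k)) (u k) t =
      right_side (path_vertex \<theta> v (l - 1)) (v (Suc l)) (v l) t"
      using right_side_tile_at[OF u k, of t] right_side_tile_at[OF v l, of t] t eq by simp
  qed (use t ends[OF u k(1,2)] ends[OF v l(1,2)] in linarith)+
  then have same: "tile_at u k = tile_at v l" using pairwiseD[OF T] by blast
  have "Complex (abscissa x (depth x (i - 1))) (- depth x (i - 1)) \<in> tile_at x i"
    if "x permutes {1..n}" "1 \<le> i" "i < n" "x (Suc i) < x i" for x i
    unfolding mem_tile_at[OF that]
    using abscissa_swap_at_le[OF that] depth_le[OF that(1), of "i - 1" "Suc i"] that(2,3) by simp
  note top = this
  have "depth v (l - 1) \<le> depth u (k - 1)"
    using top[OF u k] unfolding same mem_tile_at[OF v l] by blast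
  moreover have "depth u (k - 1) \<le> depth v (l - 1)"
    using top[OF v l] unfolding same[symmetric] mem_tile_at[OF u k] by blast
  ultimately show ?thesis by simp
qed

end

section \<open>Faces of convex sets\<close>

lemma face_of_Un:
  assumes "F face_of S" "G face_of S" "convex (F \<union> G)"
  shows "F \<union> G face_of S"
  using assms unfolding face_of_def by blast

lemma extreme_point_face_of:
  assumes "S \<inter> E face_of S" "x extreme_point_of E" "x \<in> S"
  shows "{x} face_of S"
proof -
  have "x extreme_point_of S \<inter> E" using assms(2,3) by (auto simp: extreme_point_of_def)
  then have "{x} face_of S \<inter> E" by (simp add: face_of_singleton)
  then show ?thesis using assms(1) by (rule face_of_trans)
qed

lemma singleton_Int_face_of:
  assumes "S \<inter> E \<subseteq> {x}" "x extreme_point_of E" "x \<in> S \<Longrightarrow> {x} face_of S"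
  shows "S \<inter> E face_of S" "S \<inter> E face_of E"
proof -
  have "S \<inter> E = {} \<or> (S \<inter> E = {x} \<and> x \<in> S)" using assms(1) by blast
  then show "S \<inter> E face_of S" "S \<inter> E face_of E"
    using assms(2,3) by (auto simp: face_of_singleton)
qed

context elnitsky
begin

section \<open>Existence of tilings\<close>

text \<open>
  Tilings of the region of an arbitrary permutation \<open>u\<close>, in which the two boundary paths may share
  points that belong to no tile; the tiles have to fit the right boundary as well, so that
  another tile can be added there.
\<close>

definition fitting_tiling :: "(nat \<Rightarrow> nat) \<Rightarrow> complex set set \<Rightarrow> bool" where
  "fitting_tiling u T \<longleftrightarrow> finite T \<and> (\<forall>R\<in>T. \<exists>L. is_tile n \<theta> R L) \<and>
     pairwise (\<lambda>R S. interior R \<inter> interior S = {}) T \<and>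
     pairwise (\<lambda>R S. R \<inter> S face_of R \<and> R \<inter> S face_of S) T \<and>
     \<Union>T \<subseteq> region u \<and> region u \<subseteq> \<Union>T \<union> {z. Re z = abscissa id (- Im z)} \<and>
     (\<forall>S\<in>T. \<forall>k\<in>{1..n}. S \<inter> path_edge \<theta> u k face_of S \<and> S \<inter> path_edge \<theta> u k face_of path_edge \<theta> u k)"

lemma tile_at_edges:
  assumes u: "u permutes {1..n}" and k: "1 \<le> k" "k < n"
  shows "path_edge \<theta> u k face_of tile_at u k" "path_edge \<theta> u (Suc k) face_of tile_at u k"
    "path_edge \<theta> (swap_at u k) k face_of tile_at u k"
    "path_edge \<theta> (swap_at u k) (Suc k) face_of tile_at u k"
proof -
  have ne: "u (Suc k) \<noteq> u k" using permutes_inj[OF u] by (simp add: inj_eq)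
  note faces = edges_face_of_unit_rhombus[OF tile_at_labels[OF u k] ne, of "path_vertex \<theta> u (k - 1)"]
  have v: "path_vertex \<theta> (swap_at u k) (k - 1) = path_vertex \<theta> u (k - 1)"
    using k by (simp add: path_vertex_swap_at)
  show "path_edge \<theta> u k face_of tile_at u k" "path_edge \<theta> u (Suc k) face_of tile_at u k"
    "path_edge \<theta> (swap_at u k) k face_of tile_at u k"
    "path_edge \<theta> (swap_at u k) (Suc k) face_of tile_at u k"
    using faces unfolding tile_at_def path_edge_def diff_Suc_1 path_vertex_Suc path_vertex_pred[OF k(1)] v swap_at_simps
    by simp_all
qed

lemma path_vertex_extreme:
  "path_vertex \<theta> u (k - 1) extreme_point_of path_edge \<theta> u k"
  "path_vertex \<theta> u k extreme_point_of path_edge \<theta> u k"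
  by (simp_all add: path_edge_def extreme_point_of_segment)

text \<open>The old tiles lie to the left of the old path and the new tile to the right of it, so
  they meet only in the two exchanged edges, where the old tiles fit by assumption. The new path
  leaves the old one strictly between the end vertices of the exchange, so old tiles touch the new
  edges at most in these vertices.\<close>

lemma fitting_tiling_insert:
  assumes u: "u permutes {1..n}" and k: "1 \<le> k" "k < n" "u (Suc k) < u k"
    and ft: "fitting_tiling (swap_at u k) T"
  shows "fitting_tiling u (insert (tile_at u k) T)"
proof -
  define v where "v = swap_at u k"
  define R where "R = tile_at u k"
  have v: "v permutes {1..n}" unfolding v_def by (rule swap_at_permutes[OF u k(1,2)])
  have kn: "1 \<le> Suc k" "Suc k \<le> n" "k \<le> n" "k - 1 \<le> n" "k - 1 \<noteq> k" using k by auto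
  have tiles: "\<And>S. S \<in> T \<Longrightarrow> \<exists>L. is_tile n \<theta> S L" and subT: "\<And>S. S \<in> T \<Longrightarrow> S \<subseteq> region v"
    and fit: "\<And>S l. S \<in> T \<Longrightarrow> 1 \<le> l \<Longrightarrow> l \<le> n \<Longrightarrow>
      S \<inter> path_edge \<theta> v l face_of S \<and> S \<inter> path_edge \<theta> v l face_of path_edge \<theta> v l"
    using ft unfolding fitting_tiling_def v_def by auto
  have convT: "convex S" if "S \<in> T" for S
    using tiles[OF that] convex_rhombus by (auto simp: is_tile_def)
  have memR: "z \<in> R \<longleftrightarrow> depth u (k - 1) \<le> - Im z \<and> - Im z \<le> depth u (Suc k) \<and>
    abscissa v (- Im z) \<le> Re z \<and> Re z \<le> abscissa u (- Im z)" for z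
    unfolding R_def v_def by (rule mem_tile_at_iff[OF u k])
  note edges = tile_at_edges[OF u k(1,2), folded R_def v_def]
  have dv: "depth v (k - 1) = depth u (k - 1)" "depth v (Suc k) = depth u (Suc k)"
    and pv: "path_vertex \<theta> v (k - 1) = path_vertex \<theta> u (k - 1)" "path_vertex \<theta> v (Suc k) = path_vertex \<theta> u (Suc k)"
    using k by (simp_all add: v_def depth_swap_at path_vertex_swap_at)
  have dk: "depth u (k - 1) < depth u k" "depth u k < depth u (Suc k)"
    using k by (auto intro!: depth_less[OF u])
  have vu_less: "abscissa v t < abscissa u t" if "depth u (k - 1) < t" "t < depth u (Suc k)" for t
    unfolding v_def by (rule abscissa_swap_at_less[OF u k that])
  have disj: "interior S \<inter> interior R = {}" if S: "S \<in> T" for S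
  proof (rule ccontr)
    assume "interior S \<inter> interior R \<noteq> {}"
    then obtain z where "z \<in> interior (S \<inter> R)" by auto
    then obtain r where r: "r > 0" "cball z r \<subseteq> S \<inter> R" by (metis mem_interior_cball)
    have "z \<in> cball z r" "z - complex_of_real r \<in> cball z r" using r by (simp_all add: dist_norm)
    then have "z \<in> region v" "z - complex_of_real r \<in> R" using r subT[OF S] by blast+
    then show False using r by (simp add: memR region_def)
  qed
  have meet: "S \<inter> R face_of S \<and> S \<inter> R face_of R" if S: "S \<in> T" for S
  proof -
    have eq: "S \<inter> R = (S \<inter> path_edge \<theta> v k) \<union> (S \<inter> path_edge \<theta> v (Suc k))"
    proof (intro equalityI subsetI)
      fix z assume z: "z \<in> S \<inter> R"
      then have re: "Re z = abscissa v (- Im z)" using subT[OF S] by (force simp: memR region_def)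
      have "depth v (k - 1) \<le> - Im z" "- Im z \<le> depth v (Suc k)" using z unfolding memR dv Int_iff by blast+
      then have "Complex (abscissa v (- Im z)) (- (- Im z)) \<in> path_edge \<theta> v k \<union> path_edge \<theta> v (Suc k)"
        using path_edge_mem[OF v k(1) kn(3), of "- Im z"] path_edge_mem[OF v kn(1,2), of "- Im z"]
        by (cases "- Im z \<le> depth v k") auto
      moreover have "Complex (abscissa v (- Im z)) (- (- Im z)) = z" using re by (simp add: complex_eq_iff)
      ultimately show "z \<in> (S \<inter> path_edge \<theta> v k) \<union> (S \<inter> path_edge \<theta> v (Suc k))"
        using z by (metis Int_iff Un_iff)
    next
      fix z assume "z \<in> (S \<inter> path_edge \<theta> v k) \<union> (S \<inter> path_edge \<theta> v (Suc k))"
      then show "z \<in> S \<inter> R" using edges(3,4) by (auto dest: face_of_imp_subset)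
    qed
    have "convex R" unfolding R_def tile_at_def by (rule convex_rhombus)
    \<comment> \<open>A union of two faces is a face only if it is convex. Here it is, being the
      intersection of two tiles.\<close>
    then have conv: "convex ((S \<inter> path_edge \<theta> v k) \<union> (S \<inter> path_edge \<theta> v (Suc k)))"
      unfolding eq[symmetric] using convT[OF S] by (intro convex_Int)
    show ?thesis unfolding eq
      using face_of_Un[OF _ _ conv] fit[OF S k(1) kn(3)] fit[OF S kn(1,2)] edges(3,4) face_of_trans by blast
  qed
  have fit_old: "S \<inter> path_edge \<theta> u l face_of S \<and> S \<inter> path_edge \<theta> u l face_of path_edge \<theta> u l"
    if S: "S \<in> T" and l: "1 \<le> l" "l \<le> n" for S l
  proof -
    consider "l = k" | "l = Suc k" | "l \<noteq> k" "l \<noteq> Suc k" by blast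
    then show ?thesis
    proof cases
      case 1
      have sub: "S \<inter> path_edge \<theta> u k \<subseteq> {path_vertex \<theta> u (k - 1)}"
      proof
        fix z assume z: "z \<in> S \<inter> path_edge \<theta> u k"
        then obtain t where t: "depth u (k - 1) \<le> t" "t \<le> depth u k" "z = Complex (abscissa u t) (- t)"
          using path_edge_eq[OF u k(1) kn(3)] by auto
        have "abscissa u t \<le> abscissa v t" using z t subT[OF S] by (force simp: region_def)
        then have "t = depth u (k - 1)" using vu_less[of t] t dk by force
        then show "z \<in> {path_vertex \<theta> u (k - 1)}"
          using t complex_abscissa_vertex[OF u kn(4)] by simp
      qed
      have "{path_vertex \<theta> u (k - 1)} face_of S" if "path_vertex \<theta> u (k - 1) \<in> S"
        using extreme_point_face_of[of S "path_edge \<theta> v k"] fit[OF S k(1) kn(3)]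
          path_vertex_extreme(1)[of v k] that unfolding pv by blast
      from singleton_Int_face_of[OF sub path_vertex_extreme(1) this] show ?thesis using 1 by blast
    next
      case 2
      have sub: "S \<inter> path_edge \<theta> u (Suc k) \<subseteq> {path_vertex \<theta> u (Suc k)}"
      proof
        fix z assume z: "z \<in> S \<inter> path_edge \<theta> u (Suc k)"
        then obtain t where t: "depth u k \<le> t" "t \<le> depth u (Suc k)" "z = Complex (abscissa u t) (- t)"
          using path_edge_eq[OF u kn(1,2)] by auto
        have "abscissa u t \<le> abscissa v t" using z t subT[OF S] by (force simp: region_def)
        then have "t = depth u (Suc k)" using vu_less[of t] t dk by force
        then show "z \<in> {path_vertex \<theta> u (Suc k)}"
          using t complex_abscissa_vertex[OF u kn(2)] by simp
      qed
      have "{path_vertex \<theta> u (Suc k)} face_of S" if "path_vertex \<theta> u (Suc k) \<in> S"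
        using extreme_point_face_of[of S "path_edge \<theta> v (Suc k)"] fit[OF S kn(1,2)]
          path_vertex_extreme(2)[of v "Suc k"] that unfolding pv by blast
      from singleton_Int_face_of[OF sub path_vertex_extreme(2) this] show ?thesis using 2 by blast
    next
      case 3
      have "path_edge \<theta> u l = path_edge \<theta> v l"
        unfolding v_def using path_edge_swap_at[OF k(1) l(1) 3] by simp
      then show ?thesis using fit[OF S l] by simp
    qed
  qed
  have fit_new: "R \<inter> path_edge \<theta> u l face_of R \<and> R \<inter> path_edge \<theta> u l face_of path_edge \<theta> u l"
    if l: "1 \<le> l" "l \<le> n" for l
  proof -
    have ext: "{x} face_of R" if "E face_of R" "x extreme_point_of E" for E x
      using that face_of_trans by (metis face_of_singleton)
    consider "l = k \<or> l = Suc k" | "l < k" | "Suc k < l" by linarith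
    then show ?thesis
    proof cases
      case 1
      then have f: "path_edge \<theta> u l face_of R" using edges by auto
      then have "R \<inter> path_edge \<theta> u l = path_edge \<theta> u l" using face_of_imp_subset by blast
      with f show ?thesis by (simp add: face_of_refl path_edge_def)
    next
      case 2
      have "depth u l \<le> depth u (k - 1)" using 2 k by (intro depth_le[OF u]) auto
      show ?thesis
      proof (cases "l = k - 1")
        case True
        have sub: "R \<inter> path_edge \<theta> u l \<subseteq> {path_vertex \<theta> u l}"
        proof
          fix z assume z: "z \<in> R \<inter> path_edge \<theta> u l"
          then obtain t where t: "t \<le> depth u l" "z = Complex (abscissa u t) (- t)"
            using path_edge_eq[OF u l] by auto
          then have "t = depth u l" using z True by (simp add: memR)
          then show "z \<in> {path_vertex \<theta> u l}" using t complex_abscissa_vertex[OF u l(2)] by simp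
        qed
        have "{path_vertex \<theta> u l} face_of R"
          using ext[OF edges(1) path_vertex_extreme(1)] True by simp
        from singleton_Int_face_of[OF sub path_vertex_extreme(2) this] show ?thesis by blast
      next
        case False
        then have "depth u l < depth u (k - 1)" using 2 k by (intro depth_less[OF u]) auto
        then have "R \<inter> path_edge \<theta> u l = {}" by (auto simp: memR path_edge_eq[OF u l])
        then show ?thesis by simp
      qed
    next
      case 3
      show ?thesis
      proof (cases "l - 1 = Suc k")
        case True
        have sub: "R \<inter> path_edge \<theta> u l \<subseteq> {path_vertex \<theta> u (l - 1)}"
        proof
          fix z assume z: "z \<in> R \<inter> path_edge \<theta> u l"
          then obtain t where t: "depth u (l - 1) \<le> t" "z = Complex (abscissa u t) (- t)"
            using path_edge_eq[OF u l] by auto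
          then have "t = depth u (l - 1)" using z unfolding True by (simp add: memR)
          then show "z \<in> {path_vertex \<theta> u (l - 1)}" using t complex_abscissa_vertex[OF u, of "l - 1"] l by simp
        qed
        have "{path_vertex \<theta> u (l - 1)} face_of R"
          using ext[OF edges(2) path_vertex_extreme(2)] unfolding True .
        from singleton_Int_face_of[OF sub path_vertex_extreme(1) this] show ?thesis by blast
      next
        case False
        then have "depth u (Suc k) < depth u (l - 1)" using 3 l by (intro depth_less[OF u]) auto
        then have "R \<inter> path_edge \<theta> u l = {}" by (auto simp: memR path_edge_eq[OF u l])
        then show ?thesis by simp
      qed
    qed
  qed
  have reg: "region u = region v \<union> R" unfolding v_def R_def by (rule region_swap_at[OF u k])
  have "is_tile n \<theta> R {u (Suc k), u k}"
    unfolding is_tile_def R_def tile_at_def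
    using tile_at_labels[OF u k(1,2)] k(3) by (metis less_irrefl)
  moreover have "pairwise (\<lambda>R S. interior R \<inter> interior S = {}) (insert R T)"
    using ft disj by (auto simp: fitting_tiling_def pairwise_insert Int_commute)
  moreover have "pairwise (\<lambda>R S. R \<inter> S face_of R \<and> R \<inter> S face_of S) (insert R T)"
    using ft meet by (auto simp: fitting_tiling_def pairwise_insert Int_commute)
  moreover have "\<forall>S\<in>insert R T. \<forall>l\<in>{1..n}.
      S \<inter> path_edge \<theta> u l face_of S \<and> S \<inter> path_edge \<theta> u l face_of path_edge \<theta> u l"
    using fit_old fit_new by auto
  moreover have "\<Union>(insert R T) \<subseteq> region u" "region u \<subseteq> \<Union>(insert R T) \<union> {z. Re z = abscissa id (- Im z)}"
    using ft reg unfolding fitting_tiling_def v_def by auto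
  ultimately show ?thesis
    using ft tiles unfolding fitting_tiling_def R_def by blast
qed

lemma fitting_tiling_exists: "u permutes {1..n} \<Longrightarrow> \<exists>T. fitting_tiling u T"
proof (induction rule: bubble_induct)
  case id
  \<comment> \<open>For the identity the region is just the left path, whose points are exempt from
    being covered.\<close>
  have "fitting_tiling id {}" by (auto simp: fitting_tiling_def region_def)
  then show ?case ..
next
  case (swap u k)
  then show ?case using fitting_tiling_insert by blast
qed

text \<open>What might be uncovered lies on the left path. Strictly between top and bottom, full
  support leaves room to the right, so such a point is a limit of covered points; the top and bottom
  vertices are limits of points of the right path. The union of the tiles is closed.\<close>

lemma rhombic_tiling_of_fitting:
  assumes w: "w permutes {1..n}" and fs: "fully_supported n w" and n: "n \<ge> 2"
    and ft: "fitting_tiling w T"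
  shows "T \<in> rhombic_tilings n \<theta> w"
proof -
  have closed: "closed (\<Union>T)"
  proof (rule closed_Union)
    show "finite T" using ft by (simp add: fitting_tiling_def)
    have "closed S" if "is_tile n \<theta> S L" for S L
      using that closed_rhombus by (auto simp: is_tile_def)
    then show "\<forall>S\<in>T. closed S" using ft unfolding fitting_tiling_def by metis
  qed
  have cover: "z \<in> \<Union>T" if z: "z \<in> region w" "0 < - Im z" "- Im z < depth id n" for z
  proof (rule ccontr)
    assume nz: "z \<notin> \<Union>T"
    then have re: "Re z = abscissa id (- Im z)" using ft z by (auto simp: fitting_tiling_def)
    obtain r where r: "r > 0" "ball z r \<subseteq> - \<Union>T"
      using nz closed by (metis ComplI open_Compl open_contains_ball)
    \<comment> \<open>The shift is short enough to stay both in the uncovered ball and to the left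
      of the right path.\<close>
    define \<delta> where "\<delta> = min (r / 2) (abscissa w (- Im z) - abscissa id (- Im z))"
    have d: "\<delta> > 0" "\<delta> < r" "\<delta> \<le> abscissa w (- Im z) - abscissa id (- Im z)"
      using r fully_supported_abscissa_less[OF w fs n z(2,3)] by (auto simp: \<delta>_def)
    have "z + complex_of_real \<delta> \<in> region w" using z re d by (simp add: region_def)
    moreover have "Re (z + complex_of_real \<delta>) \<noteq> abscissa id (- Im (z + complex_of_real \<delta>))"
      using re d by simp
    ultimately have "z + complex_of_real \<delta> \<in> \<Union>T" using ft by (auto simp: fitting_tiling_def)
    moreover have "z + complex_of_real \<delta> \<in> ball z r" using d by (simp add: dist_norm)
    ultimately show False using r by blast
  qed
  have ends: "Complex (abscissa w t) (- t) \<in> \<Union>T" if t: "t \<in> {0..depth id n}" for t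
  proof -
    have H: "0 < depth id n" using depth_less[OF permutes_id, of 0 n] n by simp
    let ?f = "\<lambda>t. Complex (abscissa w t) (- t)"
    have "continuous_on UNIV ?f" by (intro continuous_intros continuous_weigh)
    then have "closed (?f -` \<Union>T)" using closed by (simp add: continuous_on_closed_vimage)
    moreover have "{0<..<depth id n} \<subseteq> ?f -` \<Union>T"
      using abscissa_id_le[OF w] by (auto intro!: cover[unfolded Union_iff] simp: region_def)
    ultimately have "closure {0<..<depth id n} \<subseteq> ?f -` \<Union>T" by (intro closure_minimal)
    then show ?thesis using t H by auto
  qed
  have "region w \<subseteq> \<Union>T"
  proof
    fix z assume z: "z \<in> region w"
    show "z \<in> \<Union>T"
    proof (cases "0 < - Im z \<and> - Im z < depth id n")
      case True
      then show ?thesis using cover z by blast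
    next
      case False
      then have "- Im z = 0 \<or> - Im z = depth id n" using z by (auto simp: region_def)
      then have "Re z = abscissa w (- Im z)"
        using z abscissa_ends[OF w] by (auto simp: region_def)
      then have "z = Complex (abscissa w (- Im z)) (- (- Im z))" by (simp add: complex_eq_iff)
      moreover have "- Im z \<in> {0..depth id n}" using z by (simp add: region_def)
      ultimately show ?thesis using ends by metis
    qed
  qed
  then have "\<Union>T = elnitsky_polygon n \<theta> w"
    using ft elnitsky_polygon_eq[OF w] n by (auto simp: fitting_tiling_def)
  then show ?thesis using ft by (auto simp: fitting_tiling_def rhombic_tilings_def)
qed

section \<open>Forced right-perimeter tiles\<close>

lemma weak_tiling_of_rhombic:
  assumes "w permutes {1..n}" "n \<ge> 1" "T \<in> rhombic_tilings n \<theta> w"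
  shows "weak_tiling w T"
  using assms elnitsky_polygon_eq[OF assms(1,2)] open_region_subset[of w]
  by (auto simp: rhombic_tilings_def weak_tiling_def)

lemma right_perimeter_tile_at:
  assumes u: "w permutes {1..n}" and k: "1 \<le> k" "k < n" "w (Suc k) < w k"
  shows "is_tile n \<theta> (tile_at w k) {w k, w (Suc k)}" "right_perimeter n \<theta> w (tile_at w k)"
proof -
  show "is_tile n \<theta> (tile_at w k) {w k, w (Suc k)}"
    unfolding is_tile_def tile_at_def
    using tile_at_labels[OF u k(1,2)] k(3) by (metis insert_commute less_irrefl)
  have "path_vertex \<theta> w (l - 1) \<noteq> path_vertex \<theta> w l" if "1 \<le> l" for l
    using path_vertex_pred[OF that, of w] by simp
  then have "path_edge \<theta> w l edge_of tile_at w k" if "1 \<le> l" "path_edge \<theta> w l face_of tile_at w k" for l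
    using that unfolding path_edge_def by (intro edge_of_segmentI)
  then show "right_perimeter n \<theta> w (tile_at w k)"
    using tile_at_edges[OF u k(1,2)] k unfolding right_perimeter_def by (intro exI[of _ k]) simp
qed

lemma right_perimeter_tile:
  assumes w: "w permutes {1..n}" and wt: "weak_tiling w T" and R: "R \<in> T"
    and tile: "is_tile n \<theta> R L" and rp: "right_perimeter n \<theta> w R"
  obtains k where "1 \<le> k" "k < n" "w (Suc k) < w k" "L = {w k, w (Suc k)}" "R = tile_at w k"
proof -
  obtain p i j where ij: "i \<in> {1..n}" "j \<in> {1..n}" "i < j" and L: "L = {i, j}" and Rij: "R = unit_rhombus p i j"
    using tile by (rule is_tileE)
  obtain k where k: "1 \<le> k" "k < n" and e: "path_edge \<theta> w k edge_of R" "path_edge \<theta> w (k + 1) edge_of R"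
    using rp by (auto simp: right_perimeter_def)
  have "unit_rhombus p i j \<subseteq> region w" using wt R Rij by (auto simp: weak_tiling_def)
  moreover have "path_edge \<theta> w k \<subseteq> unit_rhombus p i j" "path_edge \<theta> w (Suc k) \<subseteq> unit_rhombus p i j"
    using e Rij by (auto simp: edge_of_def dest: face_of_imp_subset)
  ultimately show ?thesis
    using tile_of_consecutive_edges[OF w k ij] that[of k] k ij(3) L Rij by (simp add: insert_commute)
qed

definition corner_positions :: "(nat \<Rightarrow> nat) \<Rightarrow> complex set set \<Rightarrow> nat set" where
  "corner_positions w T = {k. 1 \<le> k \<and> k < n \<and> w (Suc k) < w k \<and> tile_at w k \<in> T}"

lemma forced_subset_corners:
  assumes "w permutes {1..n}" "n \<ge> 1" "T \<in> rhombic_tilings n \<theta> w"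
  shows "forced_right_perimeter_tiles n \<theta> w \<subseteq> (\<lambda>k. {w k, w (Suc k)}) ` corner_positions w T"
proof
  fix F assume "F \<in> forced_right_perimeter_tiles n \<theta> w"
  then obtain R where R: "R \<in> T" "is_tile n \<theta> R F" "right_perimeter n \<theta> w R"
    using assms(3) by (auto simp: forced_right_perimeter_tiles_def)
  from right_perimeter_tile[OF assms(1) weak_tiling_of_rhombic[OF assms] this]
  obtain k where "1 \<le> k" "k < n" "w (Suc k) < w k" "F = {w k, w (Suc k)}" "R = tile_at w k" .
  with R show "F \<in> (\<lambda>k. {w k, w (Suc k)}) ` corner_positions w T"
    unfolding corner_positions_def by blast
qed

text \<open>Two such tiles would both contain the points just to the left of boundary edge
  \<open>Suc k\<close>, although their top vertices differ.\<close>

lemma consecutive_corner_positions: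
  assumes w: "w permutes {1..n}" and T: "pairwise (\<lambda>R S. interior R \<inter> interior S = {}) T"
    and k: "k \<in> corner_positions w T"
  shows "Suc k \<notin> corner_positions w T"
proof
  assume "Suc k \<in> corner_positions w T"
  with k have k: "1 \<le> k" "k < n" "w (Suc k) < w k" "tile_at w k \<in> T"
    and l: "1 \<le> Suc k" "Suc k < n" "w (Suc (Suc k)) < w (Suc k)" "tile_at w (Suc k) \<in> T"
    by (auto simp: corner_positions_def)
  have d: "depth w (k - 1) < depth w k" "depth w k < depth w (Suc k)" "depth w (Suc k) < depth w (Suc (Suc k))"
    using k l by (auto intro!: depth_less[OF w])
  obtain t where t: "depth w k < t" "t < depth w (Suc k)" using dense[OF d(2)] by blast
  have "depth w (k - 1) = depth w (Suc k - 1)"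
    by (rule overlapping_tiles_at[OF w k(1-3) w l(1-3), of t T]) (use t d k l T in auto)
  with d show False by simp
qed

lemma forced_pairI:
  assumes w: "w permutes {1..n}" and k: "1 \<le> k" "k < n" "w (Suc k) < w k"
    and "\<And>T. T \<in> rhombic_tilings n \<theta> w \<Longrightarrow> tile_at w k \<in> T"
  shows "{w k, w (Suc k)} \<in> forced_right_perimeter_tiles n \<theta> w"
proof -
  have "\<forall>T\<in>rhombic_tilings n \<theta> w. \<exists>R\<in>T. is_tile n \<theta> R {w k, w (Suc k)} \<and> right_perimeter n \<theta> w R"
    using right_perimeter_tile_at[OF w k] assms(5) by blast
  moreover have "w k \<noteq> w (Suc k)" using k(3) by simp
  ultimately show ?thesis
    using tile_at_labels[OF w k(1,2)] unfolding forced_right_perimeter_tiles_def by blast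
qed

text \<open>
  Exchanging first at \<open>k\<close> and then at an adjacent descent \<open>l\<close> yields a tiling in which the tile
  over an edge next to \<open>k\<close> is a different one.
\<close>

lemma tiling_with_two_tiles:
  assumes w: "w permutes {1..n}" and fs: "fully_supported n w"
    and k: "1 \<le> k" "k < n" "w (Suc k) < w k"
    and l: "1 \<le> l" "l < n" "swap_at w k (Suc l) < swap_at w k l"
  obtains T where "T \<in> rhombic_tilings n \<theta> w" "tile_at w k \<in> T" "tile_at (swap_at w k) l \<in> T"
proof -
  have v: "swap_at w k permutes {1..n}" by (rule swap_at_permutes[OF w k(1,2)])
  obtain T where "fitting_tiling (swap_at (swap_at w k) l) T"
    using fitting_tiling_exists[OF swap_at_permutes[OF v l(1,2)]] by blast
  from fitting_tiling_insert[OF w k fitting_tiling_insert[OF v l this]]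
  have "insert (tile_at w k) (insert (tile_at (swap_at w k) l) T) \<in> rhombic_tilings n \<theta> w"
    using rhombic_tiling_of_fitting[OF w fs] k by simp
  then show ?thesis using that by blast
qed

text \<open>If \<open>w k\<close> exceeded \<open>w (Suc (Suc k))\<close>, it could be exchanged
  with \<open>w (Suc k)\<close> and then with \<open>w (Suc (Suc k))\<close>. The tile of the second
  exchange has its lower right edge on boundary edge \<open>Suc (Suc k)\<close>, which the first
  exchange does not move, and its top vertex lies above that of the forced tile there. The second
  claim is the mirror image: \<open>w (Suc (Suc (Suc k)))\<close> moves up, and the conflict arises
  at edge \<open>Suc k\<close>.\<close>

lemma not_forced_next:
  assumes w: "w permutes {1..n}" and fs: "fully_supported n w"
    and k: "1 \<le> k" "Suc (Suc k) < n" "w (Suc k) < w k" "w (Suc (Suc (Suc k))) < w (Suc (Suc k))"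
    and all: "\<And>T. T \<in> rhombic_tilings n \<theta> w \<Longrightarrow> tile_at w k \<in> T \<and> tile_at w (Suc (Suc k)) \<in> T"
  shows "w k < w (Suc (Suc k))" "w (Suc k) < w (Suc (Suc (Suc k)))"
proof -
  have inj: "inj w" using w by (rule permutes_inj)
  have n: "n \<ge> 1" and k': "k < n" "Suc k < n" "1 \<le> Suc k" "1 \<le> Suc (Suc k)" using k by auto
  have d: "depth w (k - 1) < depth w k" "depth w k < depth w (Suc k)"
    "depth w (Suc k) < depth w (Suc (Suc k))" "depth w (Suc (Suc k)) < depth w (Suc (Suc (Suc k)))"
    using k by (auto intro!: depth_less[OF w])
  have pw: "pairwise (\<lambda>R S. interior R \<inter> interior S = {}) T" if "T \<in> rhombic_tilings n \<theta> w" for T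
    using that by (simp add: rhombic_tilings_def)
  show "w k < w (Suc (Suc k))"
  proof (rule ccontr)
    assume "\<not> w k < w (Suc (Suc k))"
    moreover have "w k \<noteq> w (Suc (Suc k))" using inj by (simp add: inj_eq)
    ultimately have less: "w (Suc (Suc k)) < w k" by simp
    let ?v = "swap_at w k"
    have v: "?v permutes {1..n}" by (rule swap_at_permutes[OF w k(1) k'(1)])
    have vl: "?v (Suc (Suc k)) < ?v (Suc k)" using less by simp
    obtain T where T: "T \<in> rhombic_tilings n \<theta> w" "tile_at ?v (Suc k) \<in> T"
      using tiling_with_two_tiles[OF w fs k(1) k'(1) k(3) k'(3,2) vl] by blast
    have dv: "depth ?v (Suc k) = depth w (Suc k)" "depth ?v (Suc (Suc k)) = depth w (Suc (Suc k))"
      using k by (simp_all add: depth_swap_at)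
    have dvk: "depth ?v k < depth w (Suc k)" using depth_less[OF v, of k "Suc k"] k' dv by simp
    obtain t where t: "depth w (Suc k) < t" "t < depth w (Suc (Suc k))" using dense[OF d(3)] by blast
    have "depth ?v (Suc k - 1) = depth w (Suc (Suc k) - 1)"
    proof (rule overlapping_tiles_at[OF v k'(3,2) vl w k'(4) k(2,4), of t T])
      show "abscissa ?v t = abscissa w t"
        by (rule abscissa_swap_at_outside[OF w k(1) k'(1)]) (use t in simp)
      show "tile_at w (Suc (Suc k)) \<in> T" using all[OF T(1)] by simp
    qed (use t d dv dvk T pw in auto)
    with dvk show False by simp
  qed
  show "w (Suc k) < w (Suc (Suc (Suc k)))"
  proof (rule ccontr)
    assume "\<not> w (Suc k) < w (Suc (Suc (Suc k)))"
    moreover have "w (Suc k) \<noteq> w (Suc (Suc (Suc k)))" using inj by (simp add: inj_eq)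
    ultimately have less: "w (Suc (Suc (Suc k))) < w (Suc k)" by simp
    let ?v = "swap_at w (Suc (Suc k))"
    have v: "?v permutes {1..n}" by (rule swap_at_permutes[OF w k'(4) k(2)])
    have vl: "?v (Suc (Suc k)) < ?v (Suc k)" using less by simp
    obtain T where T: "T \<in> rhombic_tilings n \<theta> w" "tile_at ?v (Suc k) \<in> T"
      using tiling_with_two_tiles[OF w fs k'(4) k(2,4) k'(3,2) vl] by blast
    have dv: "depth ?v k = depth w k" "depth ?v (Suc k) = depth w (Suc k)"
      using k by (simp_all add: depth_swap_at)
    have dvk: "depth w (Suc k) < depth ?v (Suc (Suc k))"
      using depth_less[OF v, of "Suc k" "Suc (Suc k)"] k dv by simp
    obtain t where t: "depth w k < t" "t < depth w (Suc k)" using dense[OF d(2)] by blast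
    have "depth ?v (Suc k - 1) = depth w (k - 1)"
    proof (rule overlapping_tiles_at[OF v k'(3,2) vl w k(1) k'(1) k(3), of t T])
      show "abscissa ?v t = abscissa w t"
        by (rule abscissa_swap_at_outside[OF w k'(4) k(2)]) (use t in simp)
      show "tile_at w k \<in> T" using all[OF T(1)] by simp
    qed (use t d dv dvk T pw in auto)
    with d dv show False by simp
  qed
qed

end

text \<open>Each pair \<open>{2j - 1, 2j}\<close> contains at most one element of a set without neighbours.\<close>

lemma card_no_neighbours:
  fixes K :: "nat set"
  assumes K: "K \<subseteq> {1..2 * m - 1}" and gap: "\<And>k. k \<in> K \<Longrightarrow> Suc k \<notin> K"
  shows "card K \<le> m" "card K = m \<Longrightarrow> K = (\<lambda>j. 2 * j - 1) ` {1..m}"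
proof -
  \<comment> \<open>\<open>?h\<close> sends both \<open>2 * j - 1\<close> and \<open>2 * j\<close>
    to \<open>j\<close>.\<close>
  let ?h = "\<lambda>k. (k + 1) div 2"
  have finK: "finite K" using K finite_subset by blast
  have inj: "inj_on ?h K"
  proof (rule inj_onI)
    fix x y assume xy: "x \<in> K" "y \<in> K" "?h x = ?h y"
    then have "x = y \<or> y = Suc x \<or> x = Suc y" by linarith
    with xy gap show "x = y" by auto
  qed
  have sub: "?h ` K \<subseteq> {1..m}"
  proof (rule image_subsetI)
    fix k assume "k \<in> K"
    with K have "1 \<le> k" "k \<le> 2 * m - 1" by auto
    then have "1 \<le> (k + 1) div 2" "(k + 1) div 2 \<le> m" by linarith+
    then show "?h k \<in> {1..m}" by simp
  qed
  have card: "card (?h ` K) = card K" by (rule card_image[OF inj])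
  then show "card K \<le> m" using card_mono[OF _ sub] by simp
  assume "card K = m"
  then have img: "?h ` K = {1..m}" using card sub by (intro card_subset_eq) auto
  have pair: "2 * j - 1 \<in> K \<or> 2 * j \<in> K" if "1 \<le> j" "j \<le> m" for j
  proof -
    have "j \<in> ?h ` K" using img that by simp
    then obtain k where "k \<in> K" "(k + 1) div 2 = j" by auto
    moreover from this have "k = 2 * j - 1 \<or> k = 2 * j" by linarith
    ultimately show ?thesis by auto
  qed
  \<comment> \<open>Downward induction: \<open>2 * m\<close> is out of range, and if
    \<open>2 * j + 2\<close> is excluded, then its partner \<open>2 * j + 1\<close> is chosen, which
    excludes its neighbour \<open>2 * j\<close>.\<close>
  have even: "2 * j \<notin> K" if "1 \<le> j" "j \<le> m" for j
    using that(2,1)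
  proof (induction rule: inc_induct)
    case base
    then show ?case using K by auto
  next
    case (step j)
    then have "2 * Suc j - 1 \<in> K" using pair[of "Suc j"] by auto
    then show ?case using gap[of "2 * j"] by auto
  qed
  show "K = (\<lambda>j. 2 * j - 1) ` {1..m}"
  proof (intro equalityI subsetI)
    fix k assume k: "k \<in> K"
    have h: "?h k \<in> {1..m}" using sub k by blast
    have "k \<noteq> 2 * ?h k" using even[of "?h k"] h k by auto
    then have "k = 2 * ?h k - 1" by linarith
    with h show "k \<in> (\<lambda>j. 2 * j - 1) ` {1..m}" by blast
  next
    fix k assume "k \<in> (\<lambda>j. 2 * j - 1) ` {1..m}"
    then show "k \<in> K" using pair even by auto
  qed
qed

theorem theorem5p1:
  fixes m :: nat and w :: "nat \<Rightarrow> nat" and \<theta> :: "nat \<Rightarrow> real"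
  assumes "m \<ge> 1"
    and "elnitsky_angles (2 * m) \<theta>"
    and "w permutes {1..2 * m}"
    and "fully_supported (2 * m) w"
  shows "maximally_many_forced (2 * m) \<theta> w \<longleftrightarrow>
    (\<forall>k. 1 \<le> k \<and> k \<le> m \<longrightarrow> w (2 * k - 1) > w (2 * k)) \<and>
    strict_mono_on {1..m} (\<lambda>k. w (2 * k - 1)) \<and>
    strict_mono_on {1..m} (\<lambda>k. w (2 * k))"
proof -
  interpret elnitsky "2 * m" \<theta> by unfold_locales (rule assms(2))
  note w = assms(3)
  have n: "1 \<le> 2 * m" "2 \<le> 2 * m" using assms(1) by auto
  have inj: "inj w" using w by (rule permutes_inj)
  define forced where "forced = forced_right_perimeter_tiles (2 * m) \<theta> w"
  define pair where "pair k = {w k, w (Suc k)}" for k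
  \<comment> \<open>Equality of the two-element sets with the entries crossed would require each of
    the two positions to be the successor of the other.\<close>
  have pair_inj: "k = l" if "pair k = pair l" for k l
    using that inj by (auto simp: pair_def doubleton_eq_iff inj_eq)
  have odd_card: "card (pair ` (\<lambda>j. 2 * j - 1) ` {1..m}) = m"
  proof -
    have "inj_on (\<lambda>j. 2 * j - 1) {1..m}" by (auto simp: inj_on_def)
    moreover have "inj_on pair A" for A using pair_inj by (auto simp: inj_on_def)
    ultimately show ?thesis by (simp add: card_image)
  qed
  have corners: "forced \<subseteq> pair ` corner_positions w T" "card (corner_positions w T) \<le> m"
    "card (corner_positions w T) = m \<Longrightarrow> corner_positions w T = (\<lambda>j. 2 * j - 1) ` {1..m}"
    "finite (corner_positions w T)"
    if T: "T \<in> rhombic_tilings (2 * m) \<theta> w" for T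
  proof -
    show "forced \<subseteq> pair ` corner_positions w T"
      using forced_subset_corners[OF w n(1) T] by (simp add: forced_def pair_def[abs_def])
    have pw: "pairwise (\<lambda>R S. interior R \<inter> interior S = {}) T" using T by (simp add: rhombic_tilings_def)
    have sub: "corner_positions w T \<subseteq> {1..2 * m - 1}" by (auto simp: corner_positions_def)
    then show "finite (corner_positions w T)" using finite_subset by blast
    show "card (corner_positions w T) \<le> m"
      "card (corner_positions w T) = m \<Longrightarrow> corner_positions w T = (\<lambda>j. 2 * j - 1) ` {1..m}"
      using card_no_neighbours[OF sub consecutive_corner_positions[OF w pw]] by blast+
  qed
  obtain T0 where "fitting_tiling w T0" using fitting_tiling_exists[OF w] by blast
  then have T0: "T0 \<in> rhombic_tilings (2 * m) \<theta> w" by (rule rhombic_tiling_of_fitting[OF w assms(4) n(2)])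
  show ?thesis
  proof
    assume "maximally_many_forced (2 * m) \<theta> w"
    then have card: "card forced = m" by (simp add: maximally_many_forced_def forced_def)
    \<comment> \<open>The \<open>m\<close> forced pairs are attained at distinct corner positions,
      of which there are at most \<open>m\<close>; so in every tiling the extremal case of the count
      occurs.\<close>
    have pos: "corner_positions w T = (\<lambda>j. 2 * j - 1) ` {1..m}"
      if T: "T \<in> rhombic_tilings (2 * m) \<theta> w" for T
    proof (rule corners(3)[OF T])
      have "card forced \<le> card (pair ` corner_positions w T)"
        using corners(1,4)[OF T] by (intro card_mono) auto
      also have "\<dots> \<le> card (corner_positions w T)" by (rule card_image_le[OF corners(4)[OF T]])
      finally show "card (corner_positions w T) = m" using card corners(2)[OF T] by simp
    qed
    have tile: "w (2 * j) < w (2 * j - 1)" "\<And>T. T \<in> rhombic_tilings (2 * m) \<theta> w \<Longrightarrow> tile_at w (2 * j - 1) \<in> T"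
      if j: "1 \<le> j" "j \<le> m" for j
    proof -
      have mem: "2 * j - 1 \<in> corner_positions w T" if "T \<in> rhombic_tilings (2 * m) \<theta> w" for T
        using pos[OF that] j by auto
      then show "\<And>T. T \<in> rhombic_tilings (2 * m) \<theta> w \<Longrightarrow> tile_at w (2 * j - 1) \<in> T"
        by (simp add: corner_positions_def)
      have "Suc (2 * j - 1) = 2 * j" using j by simp
      then show "w (2 * j) < w (2 * j - 1)" using mem[OF T0] by (simp add: corner_positions_def)
    qed
    have step: "w (2 * j - 1) < w (2 * Suc j - 1)" "w (2 * j) < w (2 * Suc j)"
      if j: "1 \<le> j" "Suc j \<le> m" for j
    proof -
      define k where "k = 2 * j - 1"
      have idx: "2 * j - 1 = k" "2 * j = Suc k" "2 * Suc j - 1 = Suc (Suc k)" "2 * Suc j = Suc (Suc (Suc k))"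
        using j by (simp_all add: k_def)
      have k: "1 \<le> k" "Suc (Suc k) < 2 * m" using j by (auto simp: k_def)
      have desc: "w (Suc k) < w k" "w (Suc (Suc (Suc k))) < w (Suc (Suc k))"
        using tile(1)[of j] tile(1)[of "Suc j"] j unfolding idx by auto
      have "tile_at w k \<in> T \<and> tile_at w (Suc (Suc k)) \<in> T" if "T \<in> rhombic_tilings (2 * m) \<theta> w" for T
        using tile(2)[of j, OF _ _ that] tile(2)[of "Suc j", OF _ _ that] j unfolding idx by auto
      from not_forced_next[OF w assms(4) k desc this] show "w (2 * j - 1) < w (2 * Suc j - 1)" "w (2 * j) < w (2 * Suc j)"
        unfolding idx by auto
    qed
    have mono: "strict_mono_on {1..m} f" if f: "\<And>j. 1 \<le> j \<Longrightarrow> Suc j \<le> m \<Longrightarrow> f j < f (Suc j)" for f :: "nat \<Rightarrow> nat"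
    proof (rule strict_mono_onI)
      fix r s assume rs: "r \<in> {1..m}" "s \<in> {1..m}" "r < s"
      have "Suc r \<le> s" using rs(3) by simp
      then have "s \<le> m \<longrightarrow> f r < f s"
      proof (induction s rule: dec_induct)
        case base
        then show ?case using f[of r] rs by simp
      next
        case (step s)
        then show ?case using f[of s] rs by simp
      qed
      with rs show "f r < f s" by simp
    qed
    show "(\<forall>k. 1 \<le> k \<and> k \<le> m \<longrightarrow> w (2 * k - 1) > w (2 * k)) \<and>
        strict_mono_on {1..m} (\<lambda>k. w (2 * k - 1)) \<and> strict_mono_on {1..m} (\<lambda>k. w (2 * k))"
    proof (intro conjI allI impI mono)
      fix j assume "1 \<le> j \<and> j \<le> m"
      then show "w (2 * j) < w (2 * j - 1)" using tile(1) by blast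
    qed (use step in blast)+
  next
    assume cond: "(\<forall>k. 1 \<le> k \<and> k \<le> m \<longrightarrow> w (2 * k - 1) > w (2 * k)) \<and>
        strict_mono_on {1..m} (\<lambda>k. w (2 * k - 1)) \<and> strict_mono_on {1..m} (\<lambda>k. w (2 * k))"
    have desc: "w (2 * k) < w (2 * k - 1)" if "1 \<le> k" "k \<le> m" for k using cond that by blast
    have odd_mono: "w (2 * r - 1) < w (2 * s - 1)" if "1 \<le> r" "r < s" "s \<le> m" for r s
      using cond that strict_mono_onD[of "{1..m}" "\<lambda>k. w (2 * k - 1)" r s] by simp
    have even_mono: "w (2 * r) < w (2 * s)" if "1 \<le> r" "r < s" "s \<le> m" for r s
      using cond that strict_mono_onD[of "{1..m}" "\<lambda>k. w (2 * k)" r s] by simp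
    have parity: "\<exists>a. (i = 2 * a - 1 \<or> i = 2 * a) \<and> 1 \<le> a" if "1 \<le> i" for i :: nat
      using that by (intro exI[of _ "(i + 1) div 2"]) linarith
    have "pair (2 * j - 1) \<in> forced" if j: "j \<in> {1..m}" for j
    proof -
      have idx: "Suc (2 * j - 1) = 2 * j" using j by simp
      have k: "1 \<le> 2 * j - 1" "2 * j - 1 < 2 * m" "w (Suc (2 * j - 1)) < w (2 * j - 1)"
        using j desc[of j] by (auto simp: idx)
      \<comment> \<open>An entry of an earlier pair is at most the odd-indexed entry of that pair,
        which is smaller by monotonicity; for \<open>right\<close> the even-indexed entries serve in
        the same way.\<close>
      have left: "w i < w (2 * j - 1)" if i: "1 \<le> i" "i < 2 * j - 1" for i
      proof -
        obtain a where a: "i = 2 * a - 1 \<or> i = 2 * a" "1 \<le> a" using parity[OF i(1)] by blast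
        then have "a < j" using i by auto
        then show ?thesis using a odd_mono[of a j] desc[of a] j by auto
      qed
      have right: "w (Suc (2 * j - 1)) < w i" if i: "Suc (2 * j - 1) < i" "i \<le> 2 * m" for i
      proof -
        obtain a where a: "i = 2 * a - 1 \<or> i = 2 * a" "1 \<le> a" using parity[of i] i by auto
        then have "j < a" "a \<le> m" using i by auto
        then show ?thesis using a even_mono[of j a] desc[of a] j by (auto simp: idx)
      qed
      have "tile_at w (2 * j - 1) \<in> T" if "T \<in> rhombic_tilings (2 * m) \<theta> w" for T
        using tile_at_in_weak_tiling[OF w k left right weak_tiling_of_rhombic[OF w n(1) that]] .
      from forced_pairI[OF w k this] show ?thesis by (simp add: forced_def pair_def)
    qed
    then have "pair ` (\<lambda>j. 2 * j - 1) ` {1..m} \<subseteq> forced" by blast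
    moreover have "finite forced" using corners(1,4)[OF T0] finite_subset by blast
    ultimately have "m \<le> card forced" using card_mono odd_card by metis
    moreover have "card forced \<le> m"
      using corners(1,2,4)[OF T0] card_mono[of "pair ` corner_positions w T0" forced]
        card_image_le[of "corner_positions w T0" pair] by force
    ultimately show "maximally_many_forced (2 * m) \<theta> w"
      by (simp add: maximally_many_forced_def forced_def)
  qed
qed

end
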